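(* Let $C$ be a conjugation on $H^2$ and let $\Phi$ be the conjugate-linear map on $\mathcal{B}$ defined by $\Phi(L)=CLC$ for $L\in\mathcal{B}$. Then the following statements are equivalent: (a) $\Phi$ leaves the collection of analytic Toeplitz operators invariant. (b) $C=\gamma C_{\lambda,a}$ for some $\gamma,\lambda\in\mathbb{T}$ and $a\in\mathbb{D}$.
   Context: $\mathbb{D}$ is the open unit disk in $\mathbb{C}$, $\mathbb{T}$ its boundary with normalized Haar measure $\sigma$. $H^2$ is the Hardy space of $\mathbb{D}$, identified via boundary functions with a closed subspace of $L^2(\mathbb{T},\sigma)$; $P:L^2\to H^2$ is the orthogonal projection; $H^\infty$ is the space of bounded analytic functions on $\mathbb{D}$. $\mathcal{B}$ is the algebra of all bounded linear operators on $H^2$. For $\phi\in L^\infty(\mathbb{T})$, the Toeplitz operator is $T_\phi f=P(\phi f)$ for $f\in H^2$; it is an analytic Toeplitz operator if its symbol is analytic, i.e. $\phi\in H^\infty$. Thus (a) says: for every $f\in H^\infty$ there is $g\in H^\infty$ with $CT_fC=T_g$. A conjugation on $H^2$ is a conjugate-linear map $C:H^2\to H^2$ with $C^2=I$ and $\langle Cx,Cy\rangle=\langle y,x\rangle$ for all $x,y$. For $a\in\mathbb{D}$, $\varphi_a(z)=\frac{a-z}{1-\bar az}$, $K_a(z)=\frac1{1-\bar az}$ and $e_a=\sqrt{1-|a|^2}\,K_a$. The set $\{\varphi_a^me_a:m\ge0\}$ is an orthonormal basis of $H^2$, and for $\lambda\in\mathbb{T}$, $C_{\lambda,a}$ is the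 conjugation on $H^2$ defined by $C_{\lambda,a}\big(\sum_{m\ge0}\mu_m\varphi_a^me_a\big)=\sum_{m\ge0}\overline{\mu_m}\,\bar\lambda^m\varphi_a^me_a$. *)

theory Defs
  imports "HOL-Analysis.Analysis"
begin

section \<open>Normalized Haar measure on the unit circle\<close>

text \<open>
  The underlying space is the circle itself, not the plane, so that measurability of a function
  \<open>complex \<Rightarrow> complex\<close> depends on its values on the circle only.
\<close>

definition circle_measure :: "complex measure" where
  "circle_measure =
     distr (uniform_measure lborel {0..2 * pi}) (restrict_space borel (sphere 0 1)) cis"

lemma space_circle_measure [simp]: "space circle_measure = sphere 0 1"
  by (simp add: circle_measure_def space_restrict_space)

lemma sets_circle_measure [measurable_cong]:
  "sets circle_measure = sets (restrict_space borel (sphere 0 1))"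
  by (simp add: circle_measure_def)

lemma emeasure_circle_measure_space: "emeasure circle_measure (sphere 0 1) = 1"
proof -
  have "continuous_on UNIV cis"
    by (simp add: continuous_on_cis continuous_on_id)
  then have cis: "cis \<in> borel_measurable borel"
    by (rule borel_measurable_continuous_onI)
  have m: "cis \<in> measurable (uniform_measure lborel {0..2 * pi}) (restrict_space borel (sphere 0 1))"
    using cis by (intro measurable_restrict_space2) (auto simp: measurable_def)
  have S: "sphere 0 1 \<in> sets (restrict_space borel (sphere (0::complex) 1))"
    by (simp add: sets_restrict_space_iff)
  have "emeasure circle_measure (sphere 0 1) =
      emeasure (uniform_measure lborel {0..2 * pi}) (space (uniform_measure lborel {0..2 * pi}))"
    unfolding circle_measure_def
    by (subst emeasure_distr[OF m S]) (simp add: vimage_def)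
  also have "\<dots> = emeasure lborel {0..2 * pi} / emeasure lborel {0..2 * pi}"
    by simp
  also have "\<dots> = 1"
    by (simp add: ennreal_divide_self)
  finally show ?thesis .
qed

interpretation circle: finite_measure circle_measure
  by (rule finite_measureI) (simp add: emeasure_circle_measure_space)

section \<open>The Hilbert space of square-integrable functions on the circle\<close>

definition square_integrable :: "(complex \<Rightarrow> complex) \<Rightarrow> bool" where
  "square_integrable f \<longleftrightarrow>
     f \<in> borel_measurable circle_measure \<and> integrable circle_measure (\<lambda>z. (cmod (f z))\<^sup>2)"

lemma square_integrable_zero: "square_integrable (\<lambda>_. 0)"
  by (simp add: square_integrable_def)

lemma square_integrable_mult_left:
  assumes "square_integrable f"
  shows "square_integrable (\<lambda>z. c * f z)"
  using assms by (auto simp: square_integrable_def norm_mult power_mult_distrib)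

lemma cmod_add_square_le: "(cmod (a + b))\<^sup>2 \<le> 2 * (cmod a)\<^sup>2 + 2 * (cmod b)\<^sup>2"
proof -
  have "(cmod (a + b))\<^sup>2 \<le> (cmod a + cmod b)\<^sup>2"
    by (intro power_mono norm_triangle_ineq) auto
  also have "\<dots> \<le> 2 * (cmod a)\<^sup>2 + 2 * (cmod b)\<^sup>2"
    using sum_squares_bound[of "cmod a" "cmod b"] by (simp add: power2_sum)
  finally show ?thesis .
qed

lemma square_integrable_add:
  assumes "square_integrable f" "square_integrable g"
  shows "square_integrable (\<lambda>z. f z + g z)"
proof -
  have [measurable]: "f \<in> borel_measurable circle_measure" "g \<in> borel_measurable circle_measure"
    using assms by (auto simp: square_integrable_def)
  have "integrable circle_measure (\<lambda>z. (cmod (f z + g z))\<^sup>2)"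
    by (rule Bochner_Integration.integrable_bound
          [where f = "\<lambda>z. 2 * (cmod (f z))\<^sup>2 + 2 * (cmod (g z))\<^sup>2"])
       (use assms in \<open>auto simp: square_integrable_def cmod_add_square_le\<close>)
  then show ?thesis by (simp add: square_integrable_def)
qed

lemma integrable_mult_cnj:
  assumes "square_integrable f" "square_integrable g"
  shows "integrable circle_measure (\<lambda>z. f z * cnj (g z))"
proof -
  have [measurable]: "f \<in> borel_measurable circle_measure" "g \<in> borel_measurable circle_measure"
    using assms by (auto simp: square_integrable_def)
  have "cmod (f z) * cmod (g z) \<le> (cmod (f z))\<^sup>2 + (cmod (g z))\<^sup>2" for z
  proof -
    have "2 * (cmod (f z) * cmod (g z)) \<le> (cmod (f z))\<^sup>2 + (cmod (g z))\<^sup>2"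
      using sum_squares_bound[of "cmod (f z)" "cmod (g z)"] by (simp add: mult.assoc)
    moreover have "0 \<le> cmod (f z) * cmod (g z)" by simp
    ultimately show ?thesis by linarith
  qed
  moreover have "(\<lambda>z. cnj (g z)) \<in> borel_measurable circle_measure"
    by (rule measurable_compose[OF _ borel_measurable_continuous_onI])
       (auto intro!: continuous_intros)
  ultimately show ?thesis
    by (intro Bochner_Integration.integrable_bound
          [where f = "\<lambda>z. (cmod (f z))\<^sup>2 + (cmod (g z))\<^sup>2" and g = "\<lambda>z. f z * cnj (g z)"])
       (use assms in \<open>auto simp: square_integrable_def norm_mult\<close>)
qed

lemma square_integrable_continuous:
  assumes "continuous_on (sphere 0 1) f"
  shows "square_integrable f"
proof -
  have m: "f \<in> borel_measurable circle_measure"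
    using borel_measurable_continuous_on_restrict[OF assms]
    by (simp add: measurable_cong_sets[OF sets_circle_measure])
  have "compact (f ` sphere 0 1)"
    by (intro compact_continuous_image assms) simp
  then obtain B where B: "\<And>z. z \<in> sphere 0 1 \<Longrightarrow> cmod (f z) \<le> B"
    using compact_imp_bounded bounded_iff by (metis imageI)
  have "integrable circle_measure (\<lambda>z. (cmod (f z))\<^sup>2)"
    by (rule circle.integrable_const_bound[where B = "B\<^sup>2"])
       (use m B in \<open>auto intro!: AE_I2 power_mono\<close>)
  with m show ?thesis by (simp add: square_integrable_def)
qed

definition l2_rel :: "(complex \<Rightarrow> complex) \<Rightarrow> (complex \<Rightarrow> complex) \<Rightarrow> bool" where
  "l2_rel f g \<longleftrightarrow> square_integrable f \<and> square_integrable g \<and> (AE z in circle_measure. f z = g z)"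

lemma part_equivp_l2_rel: "part_equivp l2_rel"
proof (rule part_equivpI)
  show "\<exists>f. l2_rel f f"
    using square_integrable_zero by (auto simp: l2_rel_def)
  show "symp l2_rel"
    by (auto simp: symp_def l2_rel_def elim: eventually_mono)
  show "transp l2_rel"
  proof (rule transpI)
    fix f g h assume *: "l2_rel f g" "l2_rel g h"
    then have "AE z in circle_measure. f z = g z" "AE z in circle_measure. g z = h z"
      by (auto simp: l2_rel_def)
    then have "AE z in circle_measure. f z = h z" by eventually_elim simp
    with * show "l2_rel f h" by (simp add: l2_rel_def)
  qed
qed

quotient_type l2 = "complex \<Rightarrow> complex" / partial: l2_rel
  by (rule part_equivp_l2_rel)

lift_definition scaleC_l2 :: "complex \<Rightarrow> l2 \<Rightarrow> l2" is "\<lambda>c f z. c * f z"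
  by (auto simp: l2_rel_def square_integrable_mult_left elim: eventually_mono)

lift_definition cinner_l2 :: "l2 \<Rightarrow> l2 \<Rightarrow> complex"
  is "\<lambda>f g. \<integral>z. f z * cnj (g z) \<partial>circle_measure"
proof -
  fix f f' g g' assume *: "l2_rel f f'" "l2_rel g g'"
  then have "AE z in circle_measure. f z = f' z" "AE z in circle_measure. g z = g' z"
    by (auto simp: l2_rel_def)
  then have "AE z in circle_measure. f z * cnj (g z) = f' z * cnj (g' z)"
    by eventually_elim simp
  with * show "(\<integral>z. f z * cnj (g z) \<partial>circle_measure) = (\<integral>z. f' z * cnj (g' z) \<partial>circle_measure)"
    by (intro integral_cong_AE)
       (auto simp: l2_rel_def intro!: borel_measurable_integrable integrable_mult_cnj)
qed

instantiation l2 :: ab_group_add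
begin

lift_definition zero_l2 :: l2 is "\<lambda>_. 0"
  by (simp add: l2_rel_def square_integrable_zero)

lift_definition plus_l2 :: "l2 \<Rightarrow> l2 \<Rightarrow> l2" is "\<lambda>f g z. f z + g z"
  unfolding l2_rel_def by (auto intro: square_integrable_add elim: eventually_elim2)

definition uminus_l2 :: "l2 \<Rightarrow> l2" where "- x = scaleC_l2 (- 1) x"

definition minus_l2 :: "l2 \<Rightarrow> l2 \<Rightarrow> l2" where "x - y = x + - (y :: l2)"

instance
proof
  fix x y z :: l2
  show "x + y + z = x + (y + z)"
    by transfer (auto simp: l2_rel_def add.assoc intro!: square_integrable_add)
  show "x + y = y + x"
    by transfer (auto simp: l2_rel_def add.commute intro!: square_integrable_add)
  show "0 + x = x"
    by transfer (auto simp: l2_rel_def)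
  show "- x + x = 0"
    unfolding uminus_l2_def by transfer (auto simp: l2_rel_def square_integrable_zero)
  show "x - y = x + - y" by (simp add: minus_l2_def)
qed

end

lemma vector_space_l2: "vector_space scaleC_l2"
proof
  fix a b :: complex and x y :: l2
  show "scaleC_l2 a (x + y) = scaleC_l2 a x + scaleC_l2 a y"
    by transfer (auto simp: l2_rel_def distrib_left
        intro!: square_integrable_add square_integrable_mult_left)
  show "scaleC_l2 (a + b) x = scaleC_l2 a x + scaleC_l2 b x"
    by transfer (auto simp: l2_rel_def distrib_right
        intro!: square_integrable_add square_integrable_mult_left)
  show "scaleC_l2 a (scaleC_l2 b x) = scaleC_l2 (a * b) x"
    by transfer (auto simp: l2_rel_def mult.assoc intro!: square_integrable_mult_left)
  show "scaleC_l2 1 x = x"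
    by transfer (auto simp: l2_rel_def)
qed

lemma cinner_l2_add_left: "cinner_l2 (x + y) z = cinner_l2 x z + cinner_l2 y z"
  by transfer (simp add: l2_rel_def distrib_right integrable_mult_cnj)

lemma cinner_l2_scaleC_left: "cinner_l2 (scaleC_l2 c x) y = c * cinner_l2 x y"
  by transfer (simp add: l2_rel_def mult.assoc)

lemma cinner_l2_commute: "cinner_l2 x y = cnj (cinner_l2 y x)"
  by transfer (simp flip: Bochner_Integration.integral_cnj add: mult.commute)

lemma cinner_l2_self: "Im (cinner_l2 x x) = 0" "0 \<le> Re (cinner_l2 x x)"
  by (transfer, simp add: l2_rel_def complex_norm_square[symmetric] del: of_real_power)+

lemma cinner_l2_eq_zero_iff: "Re (cinner_l2 x x) = 0 \<longleftrightarrow> x = 0"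
proof (transfer, goal_cases)
  case (1 f)
  then show ?case
    by (auto simp: l2_rel_def complex_norm_square[symmetric] square_integrable_zero
        square_integrable_def integral_nonneg_eq_0_iff_AE simp del: of_real_power)
qed

instantiation l2 :: real_vector
begin

definition scaleR_l2 :: "real \<Rightarrow> l2 \<Rightarrow> l2" where "scaleR_l2 r x = scaleC_l2 (of_real r) x"

instance
proof -
  interpret vs: vector_space scaleC_l2 by (rule vector_space_l2)
  show "OFCLASS(l2, real_vector_class)"
    by standard (simp_all add: scaleR_l2_def vs.scale_right_distrib vs.scale_left_distrib)
qed

end

instantiation l2 :: real_inner
begin

definition inner_l2 :: "l2 \<Rightarrow> l2 \<Rightarrow> real" where "inner_l2 x y = Re (cinner_l2 x y)"
definition norm_l2 :: "l2 \<Rightarrow> real" where "norm_l2 x = sqrt (inner x x)"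
definition dist_l2 :: "l2 \<Rightarrow> l2 \<Rightarrow> real" where "dist_l2 x y = norm (x - y)"
definition sgn_l2 :: "l2 \<Rightarrow> l2" where "sgn_l2 x = x /\<^sub>R norm x"
definition uniformity_l2 :: "(l2 \<times> l2) filter" where
  "uniformity_l2 = (INF e\<in>{0<..}. principal {(x, y). dist x y < e})"
definition open_l2 :: "l2 set \<Rightarrow> bool" where
  "open_l2 U \<longleftrightarrow> (\<forall>x\<in>U. \<forall>\<^sub>F (x', y) in uniformity. x' = x \<longrightarrow> y \<in> U)"

instance
proof
  fix r :: real and x y z :: l2 and U :: "l2 set"
  show "dist x y = norm (x - y)" by (rule dist_l2_def)
  show "sgn x = x /\<^sub>R norm x" by (rule sgn_l2_def)
  show "(uniformity :: (l2 \<times> l2) filter) = (INF e\<in>{0<..}. principal {(x, y). dist x y < e})"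
    by (rule uniformity_l2_def)
  show "open U = (\<forall>x\<in>U. \<forall>\<^sub>F (x', y) in uniformity. x' = x \<longrightarrow> y \<in> U)" by (rule open_l2_def)
  show "inner x y = inner y x"
    unfolding inner_l2_def by (subst cinner_l2_commute) simp
  show "inner (x + y) z = inner x z + inner y z"
    by (simp add: inner_l2_def cinner_l2_add_left)
  show "inner (r *\<^sub>R x) y = r * inner x y"
    by (simp add: inner_l2_def scaleR_l2_def cinner_l2_scaleC_left)
  show "0 \<le> inner x x" by (simp add: inner_l2_def cinner_l2_self)
  show "inner x x = 0 \<longleftrightarrow> x = 0" by (simp add: inner_l2_def cinner_l2_eq_zero_iff)
  show "norm x = sqrt (inner x x)" by (rule norm_l2_def)
qed

end

lemma norm_scaleC_l2: "norm (scaleC_l2 c x) = cmod c * norm x"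
proof -
  have "cinner_l2 (scaleC_l2 c x) (scaleC_l2 c x) = c * cnj c * cinner_l2 x x"
    by (metis cinner_l2_commute cinner_l2_scaleC_left complex_cnj_mult mult.assoc)
  also have "\<dots> = of_real ((cmod c)\<^sup>2) * cinner_l2 x x"
    by (simp only: complex_norm_square)
  finally have "inner (scaleC_l2 c x) (scaleC_l2 c x) = (cmod c)\<^sup>2 * inner x x"
    by (simp add: inner_l2_def del: of_real_power)
  then show ?thesis
    by (simp add: norm_l2_def real_sqrt_mult)
qed

lemma bounded_linear_scaleC_l2: "bounded_linear (scaleC_l2 c)"
proof -
  interpret vs: vector_space scaleC_l2 by (rule vector_space_l2)
  show ?thesis
    by (rule bounded_linear_intro[where K = "cmod c"])
       (simp_all add: vs.scale_right_distrib scaleR_l2_def norm_scaleC_l2 mult.commute)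
qed

section \<open>The Hardy spaces\<close>

definition hardy2_disk :: "(complex \<Rightarrow> complex) set" where
  "hardy2_disk = {f. f holomorphic_on ball 0 1 \<and>
     bdd_above ((\<lambda>r::real. \<integral>z. (cmod (f (of_real r * z)))\<^sup>2 \<partial>circle_measure) ` {0<..<1})}"

definition hinf_disk :: "(complex \<Rightarrow> complex) set" where
  "hinf_disk = {f. f holomorphic_on ball 0 1 \<and> bounded (f ` ball 0 1)}"

text \<open>The class in \<open>L\<^sup>2\<close> of a function; meaningful only for square-integrable functions.\<close>

abbreviation l2_class :: "(complex \<Rightarrow> complex) \<Rightarrow> l2" where
  "l2_class \<equiv> abs_l2"

text \<open>
  Boundary functions are taken as limits in \<open>L\<^sup>2\<close> of the dilates \<open>z \<mapsto> f (r z)\<close> as \<open>r\<close> increases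
  to \<open>1\<close>. For functions in the Hardy spaces this limit is also the pointwise almost everywhere
  radial limit.
\<close>

definition has_boundary_function :: "(complex \<Rightarrow> complex) \<Rightarrow> l2 \<Rightarrow> bool" where
  "has_boundary_function f u \<longleftrightarrow>
     ((\<lambda>r::real. l2_class (\<lambda>z. f (of_real r * z))) \<longlongrightarrow> u) (at_left 1)"

lemma square_integrable_dilate:
  assumes f: "f holomorphic_on ball 0 1" and r: "r \<in> {0<..<1::real}"
  shows "square_integrable (\<lambda>z. f (of_real r * z))"
proof (rule square_integrable_continuous)
  have "continuous_on (ball 0 1) f"
    using f by (rule holomorphic_on_imp_continuous_on)
  then show "continuous_on (sphere 0 1) (\<lambda>z. f (of_real r * z))"
    by (rule continuous_on_compose2) (use r in \<open>auto intro!: continuous_intros simp: norm_mult\<close>)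
qed

lemma l2_class_add:
  "square_integrable f \<Longrightarrow> square_integrable g \<Longrightarrow>
     l2_class (\<lambda>z. f z + g z) = l2_class f + l2_class g"
  by (simp add: plus_l2.abs_eq l2_rel_def)

lemma l2_class_scaleC:
  "square_integrable f \<Longrightarrow> l2_class (\<lambda>z. c * f z) = scaleC_l2 c (l2_class f)"
  by (simp add: scaleC_l2.abs_eq l2_rel_def)

lemma eventually_at_left_1: "eventually (\<lambda>r::real. r \<in> {0<..<1}) (at_left 1)"
  by (rule eventually_at_leftI[where a = 0]) auto

lemma has_boundary_function_add:
  assumes "f holomorphic_on ball 0 1" "g holomorphic_on ball 0 1"
    and "has_boundary_function f u" "has_boundary_function g v"
  shows "has_boundary_function (\<lambda>z. f z + g z) (u + v)"
proof -
  let ?d = "\<lambda>f (r::real). l2_class (\<lambda>z. f (of_real r * z))"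
  have "((\<lambda>r. ?d f r + ?d g r) \<longlongrightarrow> u + v) (at_left 1)"
    using assms(3,4) unfolding has_boundary_function_def by (rule tendsto_add)
  moreover have "\<forall>\<^sub>F r in at_left 1. ?d f r + ?d g r = ?d (\<lambda>z. f z + g z) r"
    using eventually_at_left_1
    by eventually_elim (simp add: l2_class_add assms(1,2) square_integrable_dilate)
  ultimately show ?thesis
    unfolding has_boundary_function_def by (rule Lim_transform_eventually)
qed

lemma has_boundary_function_scaleC:
  assumes "f holomorphic_on ball 0 1" "has_boundary_function f u"
  shows "has_boundary_function (\<lambda>z. c * f z) (scaleC_l2 c u)"
proof -
  let ?d = "\<lambda>f (r::real). l2_class (\<lambda>z. f (of_real r * z))"
  have "((\<lambda>r. scaleC_l2 c (?d f r)) \<longlongrightarrow> scaleC_l2 c u) (at_left 1)"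
    using assms(2) unfolding has_boundary_function_def
    by (rule bounded_linear.tendsto[OF bounded_linear_scaleC_l2])
  moreover have "\<forall>\<^sub>F r in at_left 1. scaleC_l2 c (?d f r) = ?d (\<lambda>z. c * f z) r"
    using eventually_at_left_1
    by eventually_elim (simp add: l2_class_scaleC assms(1) square_integrable_dilate)
  ultimately show ?thesis
    unfolding has_boundary_function_def by (rule Lim_transform_eventually)
qed

lemma hardy2_disk_zero: "(\<lambda>_. 0) \<in> hardy2_disk"
  by (auto simp: hardy2_disk_def intro!: bdd_aboveI)

lemma hardy2_disk_scaleC:
  assumes "f \<in> hardy2_disk"
  shows "(\<lambda>z. c * f z) \<in> hardy2_disk"
proof -
  obtain B where B: "\<And>r::real. r \<in> {0<..<1} \<Longrightarrow>
      (\<integral>z. (cmod (f (of_real r * z)))\<^sup>2 \<partial>circle_measure) \<le> B"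
    using assms by (force simp: hardy2_disk_def bdd_above_def)
  have "(\<integral>z. (cmod (c * f (of_real r * z)))\<^sup>2 \<partial>circle_measure) \<le> (cmod c)\<^sup>2 * B"
    if "r \<in> {0<..<1::real}" for r
    using mult_left_mono[OF B[OF that], of "(cmod c)\<^sup>2"]
    by (simp add: norm_mult power_mult_distrib)
  then show ?thesis
    using assms by (auto simp: hardy2_disk_def
        intro!: holomorphic_intros bdd_aboveI2[where M = "(cmod c)\<^sup>2 * B"])
qed

lemma hardy2_disk_add:
  assumes "f \<in> hardy2_disk" "g \<in> hardy2_disk"
  shows "(\<lambda>z. f z + g z) \<in> hardy2_disk"
proof -
  let ?I = "\<lambda>f (r::real). \<integral>z. (cmod (f (of_real r * z)))\<^sup>2 \<partial>circle_measure"
  have hol: "f holomorphic_on ball 0 1" "g holomorphic_on ball 0 1"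
    using assms by (auto simp: hardy2_disk_def)
  obtain A B where A: "\<And>r::real. r \<in> {0<..<1} \<Longrightarrow> ?I f r \<le> A"
    and B: "\<And>r::real. r \<in> {0<..<1} \<Longrightarrow> ?I g r \<le> B"
    using assms unfolding hardy2_disk_def bdd_above_def mem_Collect_eq ball_simps by blast
  have "?I (\<lambda>z. f z + g z) r \<le> 2 * A + 2 * B" if r: "r \<in> {0<..<1::real}" for r
  proof -
    have si: "square_integrable (\<lambda>z. f (of_real r * z))" "square_integrable (\<lambda>z. g (of_real r * z))"
      by (auto intro!: square_integrable_dilate hol r)
    have "?I (\<lambda>z. f z + g z) r \<le>
        (\<integral>z. 2 * (cmod (f (of_real r * z)))\<^sup>2 + 2 * (cmod (g (of_real r * z)))\<^sup>2 \<partial>circle_measure)"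
      using si square_integrable_add[OF si]
      by (intro integral_mono cmod_add_square_le) (auto simp: square_integrable_def)
    also have "\<dots> = 2 * ?I f r + 2 * ?I g r"
      using si by (simp add: square_integrable_def)
    also have "\<dots> \<le> 2 * A + 2 * B"
      using A[OF r] B[OF r] by simp
    finally show ?thesis .
  qed
  then show ?thesis
    using hol by (auto simp: hardy2_disk_def
        intro!: holomorphic_intros bdd_aboveI2[where M = "2 * A + 2 * B"])
qed

text \<open>The Hardy space \<open>H\<^sup>2\<close>, identified via boundary functions with a subspace of \<open>L\<^sup>2\<close>.\<close>

typedef h2 = "{u. \<exists>f\<in>hardy2_disk. has_boundary_function f u}"
  morphisms l2_of_h2 h2_of_l2
proof -
  have "l2_class (\<lambda>_. 0) = 0" by (simp add: zero_l2_def)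
  then have "has_boundary_function (\<lambda>_. 0) 0" by (simp add: has_boundary_function_def)
  then show ?thesis using hardy2_disk_zero by blast
qed

setup_lifting type_definition_h2

lift_definition scaleC_h2 :: "complex \<Rightarrow> h2 \<Rightarrow> h2" is scaleC_l2
proof -
  fix c and u :: l2
  assume "\<exists>f\<in>hardy2_disk. has_boundary_function f u"
  then obtain f where f: "f \<in> hardy2_disk" "has_boundary_function f u" by blast
  then have "f holomorphic_on ball 0 1" by (simp add: hardy2_disk_def)
  then show "\<exists>f\<in>hardy2_disk. has_boundary_function f (scaleC_l2 c u)"
    using f hardy2_disk_scaleC has_boundary_function_scaleC by blast
qed

lift_definition cinner_h2 :: "h2 \<Rightarrow> h2 \<Rightarrow> complex" is cinner_l2 .

instantiation h2 :: ab_group_add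
begin

lift_definition zero_h2 :: h2 is 0
proof -
  have "l2_class (\<lambda>_. 0) = 0" by (simp add: zero_l2_def)
  then have "has_boundary_function (\<lambda>_. 0) 0" by (simp add: has_boundary_function_def)
  then show "\<exists>f\<in>hardy2_disk. has_boundary_function f 0" using hardy2_disk_zero by blast
qed

lift_definition plus_h2 :: "h2 \<Rightarrow> h2 \<Rightarrow> h2" is "(+)"
proof -
  fix u v :: l2
  assume "\<exists>f\<in>hardy2_disk. has_boundary_function f u" "\<exists>f\<in>hardy2_disk. has_boundary_function f v"
  then obtain f g where f: "f \<in> hardy2_disk" "has_boundary_function f u"
    and g: "g \<in> hardy2_disk" "has_boundary_function g v" by blast
  then have "f holomorphic_on ball 0 1" "g holomorphic_on ball 0 1" by (simp_all add: hardy2_disk_def)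
  then show "\<exists>f\<in>hardy2_disk. has_boundary_function f (u + v)"
    using f g hardy2_disk_add has_boundary_function_add by blast
qed

definition uminus_h2 :: "h2 \<Rightarrow> h2" where "- x = scaleC_h2 (- 1) x"

definition minus_h2 :: "h2 \<Rightarrow> h2 \<Rightarrow> h2" where "x - y = x + - (y :: h2)"

instance
proof
  fix x y z :: h2
  show "x + y + z = x + (y + z)" by transfer (rule add.assoc)
  show "x + y = y + x" by transfer (rule add.commute)
  show "0 + x = x" by transfer simp
  show "- x + x = 0"
    unfolding uminus_h2_def by transfer (simp flip: uminus_l2_def)
  show "x - y = x + - y" by (simp add: minus_h2_def)
qed

end

lemma vector_space_h2: "vector_space scaleC_h2"
proof -
  interpret vs: vector_space scaleC_l2 by (rule vector_space_l2)
  show ?thesis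
    by unfold_locales (transfer, simp add: vs.scale_right_distrib vs.scale_left_distrib)+
qed

instantiation h2 :: real_vector
begin

definition scaleR_h2 :: "real \<Rightarrow> h2 \<Rightarrow> h2" where "scaleR_h2 r x = scaleC_h2 (of_real r) x"

instance
proof -
  interpret vs: vector_space scaleC_h2 by (rule vector_space_h2)
  show "OFCLASS(h2, real_vector_class)"
    by standard (simp_all add: scaleR_h2_def vs.scale_right_distrib vs.scale_left_distrib)
qed

end

instantiation h2 :: real_inner
begin

definition inner_h2 :: "h2 \<Rightarrow> h2 \<Rightarrow> real" where "inner_h2 x y = Re (cinner_h2 x y)"
definition norm_h2 :: "h2 \<Rightarrow> real" where "norm_h2 x = sqrt (inner x x)"
definition dist_h2 :: "h2 \<Rightarrow> h2 \<Rightarrow> real" where "dist_h2 x y = norm (x - y)"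
definition sgn_h2 :: "h2 \<Rightarrow> h2" where "sgn_h2 x = x /\<^sub>R norm x"
definition uniformity_h2 :: "(h2 \<times> h2) filter" where
  "uniformity_h2 = (INF e\<in>{0<..}. principal {(x, y). dist x y < e})"
definition open_h2 :: "h2 set \<Rightarrow> bool" where
  "open_h2 U \<longleftrightarrow> (\<forall>x\<in>U. \<forall>\<^sub>F (x', y) in uniformity. x' = x \<longrightarrow> y \<in> U)"

instance
proof
  fix r :: real and x y z :: h2 and U :: "h2 set"
  show "dist x y = norm (x - y)" by (rule dist_h2_def)
  show "sgn x = x /\<^sub>R norm x" by (rule sgn_h2_def)
  show "(uniformity :: (h2 \<times> h2) filter) = (INF e\<in>{0<..}. principal {(x, y). dist x y < e})"
    by (rule uniformity_h2_def)
  show "open U = (\<forall>x\<in>U. \<forall>\<^sub>F (x', y) in uniformity. x' = x \<longrightarrow> y \<in> U)" by (rule open_h2_def)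
  show "inner x y = inner y x"
    unfolding inner_h2_def by (transfer, subst cinner_l2_commute) simp
  show "inner (x + y) z = inner x z + inner y z"
    unfolding inner_h2_def by transfer (simp add: cinner_l2_add_left)
  show "inner (r *\<^sub>R x) y = r * inner x y"
    unfolding inner_h2_def scaleR_h2_def by transfer (simp add: cinner_l2_scaleC_left)
  show "0 \<le> inner x x" unfolding inner_h2_def by transfer (simp add: cinner_l2_self)
  show "inner x x = 0 \<longleftrightarrow> x = 0"
    unfolding inner_h2_def by transfer (simp add: cinner_l2_eq_zero_iff)
  show "norm x = sqrt (inner x x)" by (rule norm_h2_def)
qed

end

section \<open>Operators on the Hardy space\<close>

definition h2_operators :: "(h2 \<Rightarrow> h2) set" where
  "h2_operators =
     {L. bounded_linear L \<and> (\<forall>c x. L (scaleC_h2 c x) = scaleC_h2 c (L x))}"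

definition h2_conjugation :: "(h2 \<Rightarrow> h2) \<Rightarrow> bool" where
  "h2_conjugation C \<longleftrightarrow>
     (\<forall>x y. C (x + y) = C x + C y) \<and>
     (\<forall>c x. C (scaleC_h2 c x) = scaleC_h2 (cnj c) (C x)) \<and>
     (\<forall>x. C (C x) = x) \<and>
     (\<forall>x y. cinner_h2 (C x) (C y) = cinner_h2 y x)"

definition h2_projection :: "l2 \<Rightarrow> h2" where
  "h2_projection u = (THE h. \<forall>g. cinner_l2 (u - l2_of_h2 h) (l2_of_h2 g) = 0)"

definition linf :: "(complex \<Rightarrow> complex) set" where
  "linf = {\<phi>. \<phi> \<in> borel_measurable circle_measure \<and>
     (\<exists>B. AE z in circle_measure. cmod (\<phi> z) \<le> B)}"

text \<open>\<open>rep_l2\<close> chooses a representative; for \<open>\<phi>\<close> in \<open>linf\<close> the class of the product does not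
  depend on that choice.\<close>

definition toeplitz :: "(complex \<Rightarrow> complex) \<Rightarrow> h2 \<Rightarrow> h2" where
  "toeplitz \<phi> f = h2_projection (l2_class (\<lambda>z. \<phi> z * rep_l2 (l2_of_h2 f) z))"

text \<open>The symbol \<open>\<phi>\<close> is analytic if it is the boundary function of some \<open>f\<close> in \<open>H\<^sup>\<infinity>\<close>.\<close>

definition analytic_toeplitz :: "(h2 \<Rightarrow> h2) set" where
  "analytic_toeplitz =
     {toeplitz \<phi> | \<phi>. \<phi> \<in> linf \<and> (\<exists>f\<in>hinf_disk. has_boundary_function f (l2_class \<phi>))}"

section \<open>The conjugations \<open>C\<^bsub>\<lambda>,a\<^esub>\<close>\<close>

definition disk_aut :: "complex \<Rightarrow> complex \<Rightarrow> complex" where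
  "disk_aut a z = (a - z) / (1 - cnj a * z)"

definition szego_kernel :: "complex \<Rightarrow> complex \<Rightarrow> complex" where
  "szego_kernel a z = 1 / (1 - cnj a * z)"

definition normalized_kernel :: "complex \<Rightarrow> complex \<Rightarrow> complex" where
  "normalized_kernel a z = of_real (sqrt (1 - (cmod a)\<^sup>2)) * szego_kernel a z"

definition h2_of_disk :: "(complex \<Rightarrow> complex) \<Rightarrow> h2" where
  "h2_of_disk f = (THE x. has_boundary_function f (l2_of_h2 x))"

definition aut_basis :: "complex \<Rightarrow> nat \<Rightarrow> h2" where
  "aut_basis a m = h2_of_disk (\<lambda>z. disk_aut a z ^ m * normalized_kernel a z)"

text \<open>
  The parameter \<open>\<lambda>\<close> is written \<open>l\<close>.
  The value at \<open>x = (\<Sum>m. \<mu> m \<phi>\<^sub>a\<^sup>m e\<^sub>a)\<close> is the sum of the series with coefficients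
  \<open>cnj (\<mu> m) * cnj l ^ m\<close>; both series converge in the norm of \<open>H\<^sup>2\<close>.
\<close>

definition C_conj :: "complex \<Rightarrow> complex \<Rightarrow> h2 \<Rightarrow> h2" where
  "C_conj l a x = (THE y. \<exists>\<mu>.
     (\<lambda>m. scaleC_h2 (\<mu> m) (aut_basis a m)) sums x \<and>
     (\<lambda>m. scaleC_h2 (cnj (\<mu> m) * cnj l ^ m) (aut_basis a m)) sums y)"

end

theory Submission
  imports Defs "HOL-Complex_Analysis.Complex_Analysis"
begin

text \<open>An element \<open>x\<close> of \<open>H\<^sup>2\<close> is handled through its holomorphic function \<open>disk_fun x\<close> on the disk, whose
  value at \<open>z\<close> is the inner product of \<open>x\<close> with the Szego kernel at \<open>z\<close>. In these terms the analytic
  Toeplitz operators are exactly the operators that multiply all disk functions by one fixed bounded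
  function (\<open>analytic_toeplitz_multiplier\<close>, \<open>analytic_toeplitzI\<close>). The vectors \<open>aut_basis a m\<close>
  are orthonormal and expand every element (\<open>aut_basis_sums\<close>). Convergence of the transformed series
  comes from the continuity of the given conjugation.

  Suppose that \<open>C\<close> is a unimodular multiple of \<open>C_conj l a\<close>, and put
  \<open>\<psi> z = disk_aut a (l * cnj (disk_aut a z))\<close>, an antiholomorphic involution of the disk. Comparing
  expansions shows that the disk function of \<open>C x\<close> at \<open>z\<close> is, up to a factor depending on \<open>z\<close> only, the
  conjugate of that of \<open>x\<close> at \<open>\<psi> z\<close> (\<open>disk_fun_C_conj\<close>). Hence \<open>C\<close> turns multiplication by \<open>g\<close> into
  multiplication by the bounded function \<open>cnj (g (\<psi> z))\<close>.

  Conversely, suppose that \<open>C L C\<close> is an analytic Toeplitz operator whenever \<open>L\<close> is one. Kernels are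
  the eigenvectors of the adjoint of the shift, and they are eigenvectors of the adjoint of every analytic
  Toeplitz operator. Applying this to \<open>C T\<^sub>z C\<close> shows that \<open>C\<close> maps the kernel at \<open>z\<close> to a multiple of
  the kernel at \<open>\<psi> z\<close>, where \<open>cnj \<psi>\<close> is the multiplier of \<open>C T\<^sub>z C\<close> and so holomorphic
  (\<open>conjugation_maps_kernels\<close>). As \<open>C\<close> preserves the angles between kernels and is an involution, \<open>\<psi>\<close> is
  an antiholomorphic involution of the disk that preserves the pseudo-hyperbolic distance, and it fixes
  the midpoint \<open>a\<close> between \<open>0\<close> and \<open>\<psi> 0\<close> (\<open>antiholomorphic_involution_fixed_point\<close>). At this \<open>a\<close>
  the Schwarz lemma makes \<open>C\<close> conjugate multiplication by \<open>disk_aut a\<close> into a unimodular multiple of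
  itself, so \<open>C\<close> acts on \<open>aut_basis a\<close> as \<open>C_conj l a\<close> does, up to one unimodular constant
  (\<open>conjugation_is_C_conj\<close>).\<close>

section \<open>Integration over the circle and the disk algebra\<close>

definition disk_algebra :: "(complex \<Rightarrow> complex) set" where
  "disk_algebra = {F. continuous_on (cball 0 1) F \<and> F holomorphic_on ball 0 1}"

lemma disk_algebraI:
  "continuous_on (cball 0 1) F \<Longrightarrow> F holomorphic_on ball 0 1 \<Longrightarrow> F \<in> disk_algebra"
  by (simp add: disk_algebra_def)

lemma disk_algebra_holomorphicI: "F holomorphic_on cball 0 1 \<Longrightarrow> F \<in> disk_algebra"
  by (intro disk_algebraI holomorphic_on_imp_continuous_on)
     (auto elim: holomorphic_on_subset)

lemma disk_algebraD:
  assumes "F \<in> disk_algebra"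
  shows "continuous_on (cball 0 1) F" "F holomorphic_on ball 0 1" "continuous_on (sphere 0 1) F"
  using assms by (auto simp: disk_algebra_def elim: continuous_on_subset)

lemma disk_algebra_mult:
  assumes "F \<in> disk_algebra" "G \<in> disk_algebra"
  shows "(\<lambda>z. F z * G z) \<in> disk_algebra"
  using assms by (auto simp: disk_algebra_def intro!: continuous_intros holomorphic_intros)

lemma disk_algebra_const: "(\<lambda>z. c) \<in> disk_algebra"
  by (auto simp: disk_algebra_def)

lemma disk_algebra_ident: "(\<lambda>z. z) \<in> disk_algebra"
  by (simp add: disk_algebra_def)

lemma disk_algebra_power: "F \<in> disk_algebra \<Longrightarrow> (\<lambda>z. F z ^ n) \<in> disk_algebra"
  by (auto simp: disk_algebra_def intro!: continuous_intros holomorphic_intros)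

lemma disk_algebra_sum:
  "(\<And>i. i \<in> I \<Longrightarrow> F i \<in> disk_algebra) \<Longrightarrow> (\<lambda>z. \<Sum>i\<in>I. F i z) \<in> disk_algebra"
  by (auto simp: disk_algebra_def intro!: continuous_intros holomorphic_intros)

lemma disk_algebra_compose:
  assumes "F \<in> disk_algebra" "G \<in> disk_algebra"
    and "G ` cball 0 1 \<subseteq> cball 0 1" "G ` ball 0 1 \<subseteq> ball 0 1"
  shows "(\<lambda>z. F (G z)) \<in> disk_algebra"
  using assms unfolding disk_algebra_def
  by (auto intro: continuous_on_compose2[where t = "cball 0 1"]
      holomorphic_on_compose_gen[where t = "ball 0 1", unfolded o_def])

lemma disk_algebra_dilate:
  assumes f: "f holomorphic_on ball 0 1" and r: "r \<in> {0<..<1::real}"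
  shows "(\<lambda>z. f (of_real r * z)) \<in> disk_algebra"
proof (rule disk_algebra_holomorphicI)
  have "(\<lambda>z. of_real r * z) holomorphic_on cball 0 1" by (intro holomorphic_intros)
  moreover have "(\<lambda>z. of_real r * z) ` cball 0 1 \<subseteq> ball (0::complex) 1"
  proof (rule image_subsetI)
    fix z :: complex assume "z \<in> cball 0 1"
    then have "r * cmod z \<le> r * 1" using r by (intro mult_left_mono) auto
    moreover have "r < 1" using r by simp
    ultimately have "r * cmod z < 1" by linarith
    then show "of_real r * z \<in> ball 0 1" using r by (simp add: norm_mult)
  qed
  ultimately show "(\<lambda>z. f (of_real r * z)) holomorphic_on cball 0 1"
    using holomorphic_on_compose_gen[OF _ f] by (simp add: o_def)
qed

lemma disk_algebra_bounded:
  assumes "F \<in> disk_algebra"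
  obtains B where "B > 0" "\<And>z. cmod z \<le> 1 \<Longrightarrow> cmod (F z) \<le> B"
proof -
  have "bounded (F ` cball 0 1)"
    using disk_algebraD(1)[OF assms] by (intro compact_imp_bounded compact_continuous_image) auto
  then obtain B where "B > 0" "\<forall>x\<in>F ` cball 0 1. cmod x \<le> B" by (auto simp: bounded_pos)
  then show ?thesis by (intro that[of B]) auto
qed

lemma disk_algebra_dilates_uniform:
  assumes F: "F \<in> disk_algebra" and "e > 0"
  shows "\<forall>\<^sub>F r in at_left (1::real). \<forall>z\<in>cball 0 1. cmod (F (of_real r * z) - F z) < e"
proof -
  have "uniformly_continuous_on (cball 0 1) F"
    using disk_algebraD(1)[OF F] by (rule compact_uniformly_continuous) simp
  then obtain d where d: "d > 0"
    "\<And>x x'. x \<in> cball 0 1 \<Longrightarrow> x' \<in> cball 0 1 \<Longrightarrow> dist x' x < d \<Longrightarrow> dist (F x') (F x) < e"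
    using \<open>e > 0\<close> unfolding uniformly_continuous_on_def by metis
  have "\<forall>\<^sub>F r in at_left (1::real). 1 - d < r \<and> r \<in> {0<..<1}"
    using eventually_at_left_real[of "1 - d" 1] d(1) eventually_at_left_1
    by (intro eventually_conj) (auto elim: eventually_mono)
  then show ?thesis
  proof eventually_elim
    case (elim r)
    show ?case
    proof
      fix z :: complex assume z: "z \<in> cball 0 1"
      have "dist (of_real r * z) z = cmod (of_real (1 - r) * z)"
        by (simp add: dist_norm norm_minus_commute algebra_simps)
      also have "\<dots> = (1 - r) * cmod z" using elim by (simp only: norm_mult norm_of_real) auto
      also have "\<dots> \<le> (1 - r) * 1" using elim z by (intro mult_left_mono) auto
      finally have "dist (of_real r * z) z < d" using elim by auto
      moreover have "of_real r * z \<in> cball 0 1"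
        using elim z by (simp add: norm_mult mult_le_one)
      ultimately show "cmod (F (of_real r * z) - F z) < e"
        using d(2)[OF z] by (simp add: dist_norm)
    qed
  qed
qed

text \<open>A dilate extends holomorphically past the closed disk, where its Taylor series converges
  uniformly; the dilates in turn approximate the function itself.\<close>

lemma disk_algebra_polynomials_dense:
  assumes F: "F \<in> disk_algebra" and "e > 0"
  obtains c n where "\<And>z. cmod z \<le> 1 \<Longrightarrow> cmod (F z - (\<Sum>i<n. c i * z ^ i)) < e"
proof -
  from disk_algebra_dilates_uniform[OF F, of "e/2"] eventually_at_left_1 \<open>e > 0\<close>
  have "\<forall>\<^sub>F r in at_left (1::real). (\<forall>z\<in>cball 0 1. cmod (F (of_real r * z) - F z) < e/2) \<and> r \<in> {0<..<1}"
    by (intro eventually_conj) auto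
  then obtain r where r: "\<And>z. z \<in> cball 0 1 \<Longrightarrow> cmod (F (of_real r * z) - F z) < e/2" "r \<in> {0<..<1}"
    using eventually_happens'[OF trivial_limit_at_left_real] by blast
  define a where "a n = (deriv ^^ n) F 0 / fact n" for n
  have sums: "(\<lambda>n. a n * z ^ n) sums F z" if "cmod z < 1" for z
    using holomorphic_power_series[OF disk_algebraD(2)[OF F], of z] that by (simp add: a_def)
  \<comment> \<open>Convergence at a point beyond \<open>r\<close> puts \<open>r\<close> strictly inside the radius of convergence, as uniform
    convergence on \<open>cball 0 r\<close> requires.\<close>
  define t where "t = (1 + r) / 2"
  have t: "r < t" "0 < t" "t < 1" using r(2) by (auto simp: t_def)
  then have "summable (\<lambda>n. a n * of_real t ^ n)"
    using sums[of "of_real t"] by (auto intro: sums_summable)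
  then have "ereal (norm (of_real t :: complex)) \<le> conv_radius a"
    by (rule conv_radius_geI)
  then have "ereal t \<le> conv_radius a" using t by simp
  moreover have "ereal r < ereal t" using t by simp
  ultimately have "ereal r < conv_radius a" by (rule order.strict_trans2[rotated])
  then have "uniform_limit (cball 0 r) (\<lambda>n x. \<Sum>i<n. a i * (x - 0) ^ i) (\<lambda>x. \<Sum>i. a i * (x - 0) ^ i) sequentially"
    by (rule powser_uniform_limit)
  then have "\<forall>\<^sub>F n in sequentially. \<forall>x\<in>cball 0 r. dist (\<Sum>i<n. a i * (x - 0) ^ i) (\<Sum>i. a i * (x - 0) ^ i) < e/2"
    using \<open>e > 0\<close> by (intro uniform_limitD) auto
  then obtain n where n: "\<And>x. x \<in> cball 0 r \<Longrightarrow> dist (\<Sum>i<n. a i * x ^ i) (\<Sum>i. a i * x ^ i) < e/2"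
    using eventually_happens'[OF sequentially_bot] by fastforce
  have "cmod (F z - (\<Sum>i<n. (a i * of_real r ^ i) * z ^ i)) < e" if z: "cmod z \<le> 1" for z
  proof -
    have rz: "cmod (of_real r * z) \<le> r" 
      using z r(2) mult_left_mono[of "cmod z" 1 r] by (simp add: norm_mult)
    then have "(\<Sum>i. a i * (of_real r * z) ^ i) = F (of_real r * z)"
      using r(2) by (intro sums_unique[symmetric] sums) auto
    then have "cmod ((\<Sum>i<n. a i * (of_real r * z) ^ i) - F (of_real r * z)) < e/2"
      using n[of "of_real r * z"] rz by (simp add: dist_norm)
    moreover have "cmod (F (of_real r * z) - F z) < e/2" using r(1) z by simp
    ultimately have "cmod (((\<Sum>i<n. a i * (of_real r * z) ^ i) - F (of_real r * z)) + (F (of_real r * z) - F z)) < e"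
      by (intro order.strict_trans1[OF norm_triangle_ineq]) simp
    then show ?thesis
      by (simp add: power_mult_distrib norm_minus_commute mult.assoc)
  qed
  then show ?thesis by (rule that)
qed

lemma circle_integral_eq_contour_integral:
  assumes f: "continuous_on (sphere 0 1) f"
  shows "(\<integral>z. f z \<partial>circle_measure) =
    contour_integral (circlepath 0 1) (\<lambda>w. f w / w) / (2 * of_real pi * \<i>)"
proof -
  have [measurable]: "f \<in> borel_measurable circle_measure"
    using square_integrable_continuous[OF f] by (simp add: square_integrable_def)
  have "continuous_on UNIV cis"
    by (simp add: continuous_on_cis continuous_on_id)
  then have cis: "cis \<in> borel_measurable borel"
    by (rule borel_measurable_continuous_onI)
  have m: "cis \<in> measurable (uniform_measure lborel {0..2 * pi}) (restrict_space borel (sphere 0 1))"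
    using cis by (intro measurable_restrict_space2) (auto simp: measurable_def)
  have m': "cis \<in> measurable lborel (restrict_space borel (sphere 0 1))"
    using cis by (intro measurable_restrict_space2) (auto simp: measurable_def)
  have fm: "f \<in> borel_measurable (restrict_space borel (sphere 0 1))"
    using \<open>f \<in> borel_measurable circle_measure\<close> by (simp add: measurable_cong_sets[OF sets_circle_measure])
  have fc: "(\<lambda>t. f (cis t)) \<in> borel_measurable lborel"
    using measurable_compose[OF m' fm] .
  have um: "uniform_measure lborel {0..2 * pi} = density lborel (\<lambda>t. ennreal (indicator {0..2*pi} t / (2 * pi)))"
    unfolding uniform_measure_def
  proof (intro density_cong AE_I2)
    fix t :: real
    show "indicator {0..2*pi} t / emeasure lborel {0..2*pi} = ennreal (indicator {0..2*pi} t / (2*pi))"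
      using divide_ennreal[of "indicator {0..2*pi} t" "2*pi"] by (simp add: ennreal_indicator)
  qed auto
  have cont: "continuous_on {0..2*pi} (\<lambda>t. f (cis t))"
    by (rule continuous_on_compose2[OF f]) (auto intro!: continuous_intros)
  then have si: "set_integrable lborel {0..2*pi} (\<lambda>t. f (cis t))"
    by (rule borel_integrable_atLeastAtMost')
  have "(\<integral>z. f z \<partial>circle_measure) = (\<integral>t. f (cis t) \<partial>uniform_measure lborel {0..2 * pi})"
    unfolding circle_measure_def by (rule integral_distr[OF m fm])
  also have "\<dots> = (\<integral>t. (indicator {0..2*pi} t / (2 * pi)) *\<^sub>R f (cis t) \<partial>lborel)"
    unfolding um by (rule integral_density) (use fc in auto)
  also have "\<dots> = (\<integral>t. (1 / (2*pi)) *\<^sub>R (indicator {0..2*pi} t *\<^sub>R f (cis t)) \<partial>lborel)"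
    by (intro Bochner_Integration.integral_cong) (auto simp: field_simps)
  also have "\<dots> = (1 / (2*pi)) *\<^sub>R (LINT t:{0..2*pi}|lborel. f (cis t))"
    unfolding set_lebesgue_integral_def by (rule integral_scaleR_right)
  also have "\<dots> = (1 / (2*pi)) *\<^sub>R integral {0..2*pi} (\<lambda>t. f (cis t))"
    using set_borel_integral_eq_integral(2)[OF si] by simp
  finally have 1: "(\<integral>z. f z \<partial>circle_measure) = (1 / (2*pi)) *\<^sub>R integral {0..2*pi} (\<lambda>t. f (cis t))" .
  have "contour_integral (circlepath 0 1) (\<lambda>w. f w / w) = integral {0..2*pi} (\<lambda>t. f (cis t) * \<i>)"
    unfolding circlepath_def by (subst contour_integral_part_circlepath_eq) auto
  also have "\<dots> = integral {0..2*pi} (\<lambda>t. f (cis t)) * \<i>"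
    by (rule integral_mult_left)
  finally show ?thesis unfolding 1 by (simp add: scaleR_conv_of_real field_simps)
qed

lemma norm_cnj_mult_less_1:
  assumes "cmod a < 1" "cmod w \<le> 1"
  shows "cmod (cnj a * w) < 1" "1 - cnj a * w \<noteq> 0" "1 - a * cnj w \<noteq> 0"
proof -
  have "cmod a * cmod w \<le> cmod a * 1" using assms by (intro mult_left_mono) auto
  then show *: "cmod (cnj a * w) < 1" using assms by (simp add: norm_mult)
  then show "1 - cnj a * w \<noteq> 0" by auto
  have "cmod (a * cnj w) < 1" using * by (simp add: norm_mult)
  then show "1 - a * cnj w \<noteq> 0" by auto
qed

lemma szego_kernel_disk_algebra: "cmod a < 1 \<Longrightarrow> szego_kernel a \<in> disk_algebra"
  unfolding szego_kernel_def
  by (intro disk_algebra_holomorphicI holomorphic_intros) (auto dest: norm_cnj_mult_less_1)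

text \<open>On the circle \<open>cnj w = 1 / w\<close>, which turns integration against the kernel into Cauchy's
  formula.\<close>

lemma circle_integral_szego:
  assumes F: "F \<in> disk_algebra" and z: "cmod z < 1"
  shows "(\<integral>w. F w * cnj (szego_kernel z w) \<partial>circle_measure) = F z"
proof -
  have "(\<integral>w. F w * cnj (szego_kernel z w) \<partial>circle_measure) =
    contour_integral (circlepath 0 1) (\<lambda>w. F w * cnj (szego_kernel z w) / w) / (2 * of_real pi * \<i>)"
    using disk_algebraD(3)[OF F] disk_algebraD(3)[OF szego_kernel_disk_algebra[OF z]]
    by (intro circle_integral_eq_contour_integral continuous_intros)
  also have "contour_integral (circlepath 0 1) (\<lambda>w. F w * cnj (szego_kernel z w) / w) =
      contour_integral (circlepath 0 1) (\<lambda>w. F w / (w - z))"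
  proof (rule contour_integral_eq)
    fix w assume "w \<in> path_image (circlepath 0 1)"
    then have w: "cmod w = 1" by simp
    then have "cnj w * w = 1" by (metis complex_mod_sqrt_Re_mult_cnj complex_norm_square mult.commute of_real_1 one_power2)
    then have "(1 - z * cnj w) * w = w - z" by (simp add: algebra_simps)
    moreover have "w \<noteq> 0" using w by auto
    ultimately show "F w * cnj (szego_kernel z w) / w = F w / (w - z)"
      by (simp add: szego_kernel_def)
  qed
  also have "\<dots> = 2 * of_real pi * \<i> * F z"
    using Cauchy_integral_circlepath[of 0 1 F z] F z
    by (intro contour_integral_unique) (auto simp: disk_algebra_def)
  finally show ?thesis by simp
qed

section \<open>Norms and inner products in \<open>L\<^sup>2\<close> and \<open>H\<^sup>2\<close>\<close>

lemma rep_l2: "square_integrable (rep_l2 u)" "l2_class (rep_l2 u) = u"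
  using Quotient3_rep_reflp[OF Quotient3_l2, of u] Quotient3_abs_rep[OF Quotient3_l2, of u]
  by (auto simp: l2_rel_def)

lemma l2_class_eqI:
  assumes "square_integrable f" "square_integrable g" "AE z in circle_measure. f z = g z"
  shows "l2_class f = l2_class g"
  using Quotient3_rel_abs[OF Quotient3_l2, of f g] assms by (simp add: l2_rel_def)

lemma l2_class_diff:
  assumes "square_integrable f" "square_integrable g"
  shows "l2_class f - l2_class g = l2_class (\<lambda>z. f z - g z)"
  using l2_class_add[OF assms(1) square_integrable_mult_left[OF assms(2), of "-1"]]
    l2_class_scaleC[OF assms(2), of "-1"]
  by (simp add: minus_l2_def uminus_l2_def)

lemma square_integrable_diff:
  assumes "square_integrable f" "square_integrable g"
  shows "square_integrable (\<lambda>z. f z - g z)"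
  using square_integrable_add[OF assms(1) square_integrable_mult_left[OF assms(2), of "-1"]] by simp

lemma square_integrable_disk_algebra: "F \<in> disk_algebra \<Longrightarrow> square_integrable F"
  by (intro square_integrable_continuous disk_algebraD)

lemma cinner_l2_class:
  assumes "square_integrable f" "square_integrable g"
  shows "cinner_l2 (l2_class f) (l2_class g) = (\<integral>z. f z * cnj (g z) \<partial>circle_measure)"
  using assms by (simp add: cinner_l2.abs_eq l2_rel_def)

lemma norm_l2_class_square:
  assumes "square_integrable f"
  shows "(norm (l2_class f))\<^sup>2 = (\<integral>z. (cmod (f z))\<^sup>2 \<partial>circle_measure)"
proof -
  have "(norm (l2_class f))\<^sup>2 = Re (\<integral>z. f z * cnj (f z) \<partial>circle_measure)"
    by (simp add: power2_norm_eq_inner inner_l2_def cinner_l2_class assms)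
  also have "\<dots> = Re (\<integral>z. of_real ((cmod (f z))\<^sup>2) \<partial>circle_measure)"
    by (simp only: complex_norm_square)
  also have "\<dots> = (\<integral>z. (cmod (f z))\<^sup>2 \<partial>circle_measure)"
    by (simp only: integral_complex_of_real Re_complex_of_real)
  finally show ?thesis .
qed

lemma norm_l2_class_le_mult:
  assumes "square_integrable f" "square_integrable g" "B \<ge> 0"
    and "AE z in circle_measure. cmod (f z) \<le> B * cmod (g z)"
  shows "norm (l2_class f) \<le> B * norm (l2_class g)"
proof (rule power2_le_imp_le)
  have "(norm (l2_class f))\<^sup>2 \<le> (\<integral>z. B\<^sup>2 * (cmod (g z))\<^sup>2 \<partial>circle_measure)"
    unfolding norm_l2_class_square[OF assms(1)]
  proof (rule integral_mono_AE)
    show "AE z in circle_measure. (cmod (f z))\<^sup>2 \<le> B\<^sup>2 * (cmod (g z))\<^sup>2"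
      using assms(4)
    proof eventually_elim
      case (elim z)
      then have "(cmod (f z))\<^sup>2 \<le> (B * cmod (g z))\<^sup>2" by (intro power_mono) auto
      then show ?case by (simp add: power_mult_distrib)
    qed
  qed (use assms in \<open>auto simp: square_integrable_def\<close>)
  also have "\<dots> = (B * norm (l2_class g))\<^sup>2"
    by (simp add: norm_l2_class_square assms power_mult_distrib)
  finally show "(norm (l2_class f))\<^sup>2 \<le> (B * norm (l2_class g))\<^sup>2" .
  show "0 \<le> B * norm (l2_class g)" using assms by simp
qed

lemma measure_circle_space: "measure circle_measure (sphere 0 1) = 1"
  by (simp add: measure_def emeasure_circle_measure_space)

lemma norm_l2_class_le:
  assumes f: "square_integrable f" and B: "\<And>z. cmod z = 1 \<Longrightarrow> cmod (f z) \<le> B"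
  shows "norm (l2_class f) \<le> B"
proof -
  have 1: "square_integrable (\<lambda>_. 1)" by (intro square_integrable_continuous continuous_intros)
  have "B \<ge> 0" using order.trans[OF norm_ge_zero[of "f 1"] B[of 1]] by simp
  moreover have "(norm (l2_class (\<lambda>_. 1)))\<^sup>2 = 1\<^sup>2"
    by (simp add: norm_l2_class_square[OF 1] measure_circle_space)
  then have "norm (l2_class (\<lambda>_. 1)) = 1" by (rule power2_eq_imp_eq) auto
  moreover have "norm (l2_class f) \<le> B * norm (l2_class (\<lambda>_. 1))"
    using \<open>B \<ge> 0\<close> B by (intro norm_l2_class_le_mult f 1 AE_I2) auto
  ultimately show ?thesis by simp
qed

lemma l2_of_h2_diff: "l2_of_h2 (x - y) = l2_of_h2 x - l2_of_h2 y"
  by (simp add: minus_h2_def minus_l2_def uminus_h2_def uminus_l2_def plus_h2.rep_eq scaleC_h2.rep_eq)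

lemma norm_l2_of_h2: "norm (l2_of_h2 x) = norm x"
  by (simp add: norm_h2_def norm_l2_def inner_h2_def inner_l2_def cinner_h2.rep_eq)

lemma cinner_h2_commute: "cinner_h2 x y = cnj (cinner_h2 y x)"
  by transfer (rule cinner_l2_commute)

lemma cinner_h2_add_left: "cinner_h2 (x + y) z = cinner_h2 x z + cinner_h2 y z"
  by transfer (rule cinner_l2_add_left)

lemma cinner_h2_scaleC_left: "cinner_h2 (scaleC_h2 c x) y = c * cinner_h2 x y"
  by transfer (rule cinner_l2_scaleC_left)

lemma cinner_h2_scaleC_right: "cinner_h2 x (scaleC_h2 c y) = cnj c * cinner_h2 x y"
  by (metis cinner_h2_commute cinner_h2_scaleC_left complex_cnj_mult)

lemma cinner_h2_self: "cinner_h2 x x = of_real ((norm x)\<^sup>2)"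
proof -
  have "Im (cinner_h2 x x) = 0" by transfer (rule cinner_l2_self)
  moreover have "Re (cinner_h2 x x) = (norm x)\<^sup>2" by (simp only: power2_norm_eq_inner inner_h2_def)
  ultimately show ?thesis by (intro complex_eqI) (simp_all only: Re_complex_of_real Im_complex_of_real)
qed

lemma norm_scaleC_h2: "norm (scaleC_h2 c x) = cmod c * norm x"
  by (metis norm_l2_of_h2 norm_scaleC_l2 scaleC_h2.rep_eq)

lemma norm_cinner_h2_le: "cmod (cinner_h2 x y) \<le> norm x * norm y"
proof (cases "cinner_h2 x y = 0")
  case False
  define c where "c = cinner_h2 x y"
  have "of_real ((cmod c)\<^sup>2) = cnj c * c"
    by (simp only: complex_norm_square mult.commute)
  then have "(cmod c)\<^sup>2 = Re (cnj c * c)" by (metis Re_complex_of_real)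
  also have "\<dots> = inner (scaleC_h2 (cnj c) x) y"
    by (simp only: inner_h2_def cinner_h2_scaleC_left c_def)
  also have "\<dots> \<le> cmod c * norm x * norm y"
    using norm_cauchy_schwarz[of "scaleC_h2 (cnj c) x" y] by (simp add: norm_scaleC_h2)
  finally show ?thesis using False by (simp add: power2_eq_square c_def mult.assoc)
qed simp

lemma bounded_linear_cinner_h2: "bounded_linear (\<lambda>x. cinner_h2 x y)"
  by (rule bounded_linear_intro[where K = "norm y"])
     (auto simp: cinner_h2_add_left scaleR_h2_def cinner_h2_scaleC_left norm_cinner_h2_le scaleR_conv_of_real)

lemma bounded_linear_scaleC_h2: "bounded_linear (scaleC_h2 c)"
proof -
  interpret vs: vector_space scaleC_h2 by (rule vector_space_h2)
  show ?thesis
    by (rule bounded_linear_intro[where K = "cmod c"])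
       (simp_all add: vs.scale_right_distrib scaleR_h2_def norm_scaleC_h2 mult.commute)
qed

section \<open>Disk functions of elements of \<open>H\<^sup>2\<close>\<close>

lemma has_boundary_function_unique:
  "has_boundary_function f u \<Longrightarrow> has_boundary_function f v \<Longrightarrow> u = v"
  unfolding has_boundary_function_def by (rule tendsto_unique[OF trivial_limit_at_left_real])

lemma square_integrable_cong:
  assumes "\<And>z. cmod z = 1 \<Longrightarrow> f z = g z"
  shows "square_integrable f \<longleftrightarrow> square_integrable g"
proof -
  have "f \<in> borel_measurable circle_measure \<longleftrightarrow> g \<in> borel_measurable circle_measure"
    using assms by (intro measurable_cong) auto
  moreover have "integrable circle_measure (\<lambda>z. (cmod (f z))\<^sup>2) \<longleftrightarrow> integrable circle_measure (\<lambda>z. (cmod (g z))\<^sup>2)"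
    using assms by (intro Bochner_Integration.integrable_cong) auto
  ultimately show ?thesis by (simp add: square_integrable_def)
qed

lemma has_boundary_function_cong:
  assumes f: "f holomorphic_on ball 0 1" and eq: "\<And>z. cmod z < 1 \<Longrightarrow> f z = g z"
    and "has_boundary_function f u"
  shows "has_boundary_function g u"
proof -
  have "\<forall>\<^sub>F r in at_left 1. l2_class (\<lambda>z. f (of_real r * z)) = l2_class (\<lambda>z. g (of_real r * z))"
    using eventually_at_left_1
  proof eventually_elim
    case (elim r)
    have eq': "f (of_real r * z) = g (of_real r * z)" if "cmod z = 1" for z
      using elim that by (intro eq) (simp add: norm_mult)
    have "square_integrable (\<lambda>z. f (of_real r * z))" using f elim by (rule square_integrable_dilate)
    moreover from this have "square_integrable (\<lambda>z. g (of_real r * z))"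
      using square_integrable_cong[of "\<lambda>z. f (of_real r * z)" "\<lambda>z. g (of_real r * z)"] eq' by blast
    ultimately show ?case using eq' by (intro l2_class_eqI AE_I2) auto
  qed
  with assms(3) show ?thesis
    unfolding has_boundary_function_def by (rule Lim_transform_eventually)
qed

text \<open>Dilates of a function continuous on the closed disk converge uniformly on the circle, hence in
  \<open>L\<^sup>2\<close>.\<close>

lemma has_boundary_function_disk_algebra:
  assumes F: "F \<in> disk_algebra"
  shows "has_boundary_function F (l2_class F)"
  unfolding has_boundary_function_def
proof (rule tendstoI)
  fix e :: real assume "e > 0"
  then have "\<forall>\<^sub>F r in at_left (1::real). \<forall>z\<in>cball 0 1. cmod (F (of_real r * z) - F z) < e/2"
    by (intro disk_algebra_dilates_uniform F) auto
  then show "\<forall>\<^sub>F r in at_left 1. dist (l2_class (\<lambda>z. F (of_real r * z))) (l2_class F) < e"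
    using eventually_at_left_1
  proof eventually_elim
    case (elim r)
    have si: "square_integrable (\<lambda>z. F (of_real r * z))" "square_integrable F"
      using elim by (auto intro!: square_integrable_dilate disk_algebraD F square_integrable_disk_algebra[OF F])
    have "norm (l2_class (\<lambda>z. F (of_real r * z) - F z)) \<le> e/2"
      using elim by (intro norm_l2_class_le square_integrable_diff si) (auto intro!: less_imp_le)
    then show ?case using \<open>e > 0\<close> by (simp add: dist_norm l2_class_diff si)
  qed
qed

lemma hinf_disk_subset_hardy2_disk: "hinf_disk \<subseteq> hardy2_disk"
proof
  fix f assume f: "f \<in> hinf_disk"
  then obtain B where B: "\<And>z. cmod z < 1 \<Longrightarrow> cmod (f z) \<le> B"
    by (force simp: hinf_disk_def bounded_iff)
  have hol: "f holomorphic_on ball 0 1" using f by (simp add: hinf_disk_def)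
  have "(\<integral>z. (cmod (f (of_real r * z)))\<^sup>2 \<partial>circle_measure) \<le> B\<^sup>2" if r: "r \<in> {0<..<1::real}" for r
  proof -
    have si: "square_integrable (\<lambda>z. f (of_real r * z))" by (rule square_integrable_dilate[OF hol r])
    have "norm (l2_class (\<lambda>z. f (of_real r * z))) \<le> B"
      using r by (intro norm_l2_class_le si B) (auto simp: norm_mult)
    then have "(norm (l2_class (\<lambda>z. f (of_real r * z))))\<^sup>2 \<le> B\<^sup>2" by (intro power_mono) auto
    then show ?thesis by (simp add: norm_l2_class_square si)
  qed
  then show "f \<in> hardy2_disk" using hol by (auto simp: hardy2_disk_def intro!: bdd_aboveI2[where M = "B\<^sup>2"])
qed

lemma disk_algebra_subset_hinf_disk: "disk_algebra \<subseteq> hinf_disk"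
proof
  fix F assume F: "F \<in> disk_algebra"
  obtain B where "\<And>z. cmod z \<le> 1 \<Longrightarrow> cmod (F z) \<le> B" using disk_algebra_bounded[OF F] by blast
  then have "bounded (F ` ball 0 1)" unfolding bounded_iff by (intro exI[of _ B]) auto
  then show "F \<in> hinf_disk" using F by (simp add: hinf_disk_def disk_algebra_def)
qed

lemma h2_of_disk_eqI: "has_boundary_function f (l2_of_h2 x) \<Longrightarrow> h2_of_disk f = x"
  unfolding h2_of_disk_def
  by (rule the_equality, assumption)
     (drule (1) has_boundary_function_unique, simp add: l2_of_h2_inject)

lemma l2_of_h2_of_l2:
  assumes "f \<in> hardy2_disk" "has_boundary_function f u"
  shows "l2_of_h2 (h2_of_l2 u) = u"
  using assms by (intro h2_of_l2_inverse) auto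

lemma l2_of_h2_of_disk:
  assumes F: "F \<in> disk_algebra"
  shows "l2_of_h2 (h2_of_disk F) = l2_class F"
proof -
  note * = has_boundary_function_disk_algebra[OF F]
  have "F \<in> hardy2_disk"
    using F disk_algebra_subset_hinf_disk hinf_disk_subset_hardy2_disk by blast
  then have "l2_of_h2 (h2_of_l2 (l2_class F)) = l2_class F" using * by (rule l2_of_h2_of_l2)
  then show ?thesis using * h2_of_disk_eqI by metis
qed

lemma cinner_h2_of_disk:
  assumes "F \<in> disk_algebra" "G \<in> disk_algebra"
  shows "cinner_h2 (h2_of_disk F) (h2_of_disk G) = (\<integral>z. F z * cnj (G z) \<partial>circle_measure)"
  using assms by (simp add: cinner_h2.rep_eq l2_of_h2_of_disk cinner_l2_class square_integrable_disk_algebra)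

abbreviation kernel_h2 :: "complex \<Rightarrow> h2" where
  "kernel_h2 z \<equiv> h2_of_disk (szego_kernel z)"

text \<open>Pairing with the Szego kernel gives the value at \<open>z\<close> of the holomorphic function whose boundary
  function is \<open>x\<close>. Defining evaluation by this pairing makes it visibly linear and continuous in \<open>x\<close>;
  \<open>disk_fun_eq\<close> identifies it with the actual function.\<close>

definition disk_fun :: "h2 \<Rightarrow> complex \<Rightarrow> complex" where
  "disk_fun x z = cinner_h2 x (kernel_h2 z)"

lemma disk_fun_h2_of_disk:
  assumes "F \<in> disk_algebra" "cmod z < 1"
  shows "disk_fun (h2_of_disk F) z = F z"
  using assms by (simp add: disk_fun_def cinner_h2_of_disk szego_kernel_disk_algebra circle_integral_szego)

lemma l2_class_dilate_eq:
  assumes f: "f holomorphic_on ball 0 1" and r: "r \<in> {0<..<1}"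
  shows "l2_class (\<lambda>z. f (of_real r * z)) = l2_of_h2 (h2_of_disk (\<lambda>z. f (of_real r * z)))"
  by (simp add: l2_of_h2_of_disk disk_algebra_dilate[OF f r])

lemma h2_of_disk_dilates_tendsto:
  assumes f: "f holomorphic_on ball 0 1" and x: "has_boundary_function f (l2_of_h2 x)"
  shows "((\<lambda>r::real. h2_of_disk (\<lambda>z. f (of_real r * z))) \<longlongrightarrow> x) (at_left 1)"
proof -
  have "((\<lambda>r::real. dist (l2_class (\<lambda>z. f (of_real r * z))) (l2_of_h2 x)) \<longlongrightarrow> 0) (at_left 1)"
    using x unfolding has_boundary_function_def by (rule tendsto_dist_iff[THEN iffD1])
  moreover have "\<forall>\<^sub>F r in at_left 1. dist (l2_class (\<lambda>z. f (of_real r * z))) (l2_of_h2 x) =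
      dist (h2_of_disk (\<lambda>z. f (of_real r * z))) x"
    using eventually_at_left_1
    by eventually_elim
       (simp only: l2_class_dilate_eq[OF f] dist_norm norm_l2_of_h2 l2_of_h2_diff[symmetric])
  ultimately have "((\<lambda>r::real. dist (h2_of_disk (\<lambda>z. f (of_real r * z))) x) \<longlongrightarrow> 0) (at_left 1)"
    by (rule Lim_transform_eventually)
  then show ?thesis by (rule tendsto_dist_iff[THEN iffD2])
qed

text \<open>The dilates lie in the disk algebra, where evaluation is Cauchy's formula; they converge to \<open>x\<close> in
  \<open>H\<^sup>2\<close> and to \<open>f\<close> pointwise.\<close>

lemma disk_fun_eq:
  assumes f: "f holomorphic_on ball 0 1" and x: "has_boundary_function f (l2_of_h2 x)"
    and z: "cmod z < 1"
  shows "disk_fun x z = f z"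
proof -
  have "((\<lambda>r::real. disk_fun (h2_of_disk (\<lambda>z. f (of_real r * z))) z) \<longlongrightarrow> disk_fun x z) (at_left 1)"
    unfolding disk_fun_def
    by (rule bounded_linear.tendsto[OF bounded_linear_cinner_h2 h2_of_disk_dilates_tendsto[OF f x]])
  moreover have "\<forall>\<^sub>F r in at_left 1. disk_fun (h2_of_disk (\<lambda>z. f (of_real r * z))) z = f (of_real r * z)"
    using eventually_at_left_1
    by eventually_elim (rule disk_fun_h2_of_disk[OF disk_algebra_dilate[OF f] z])
  ultimately have *: "((\<lambda>r::real. f (of_real r * z)) \<longlongrightarrow> disk_fun x z) (at_left 1)"
    by (rule Lim_transform_eventually)
  have "isCont f z"
    using holomorphic_on_imp_continuous_on[OF f] z by (simp add: continuous_on_eq_continuous_at)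
  moreover have "((\<lambda>r::real. of_real r * z) \<longlongrightarrow> of_real 1 * z) (at_left 1)"
    by (intro tendsto_intros)
  ultimately have "((\<lambda>r::real. f (of_real r * z)) \<longlongrightarrow> f z) (at_left 1)"
    using isCont_tendsto_compose[of z f "\<lambda>r::real. of_real r * z" "at_left 1"] by simp
  then show ?thesis using * by (blast intro: tendsto_unique[OF trivial_limit_at_left_real])
qed

lemma disk_fun_hardy2_disk: "disk_fun x \<in> hardy2_disk"
  and has_boundary_function_disk_fun: "has_boundary_function (disk_fun x) (l2_of_h2 x)"
proof -
  obtain f where f: "f \<in> hardy2_disk" "has_boundary_function f (l2_of_h2 x)"
    using l2_of_h2[of x] by blast
  then have hol: "f holomorphic_on ball 0 1" by (simp add: hardy2_disk_def)
  have eq: "f z = disk_fun x z" if "cmod z < 1" for z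
    using disk_fun_eq[OF hol f(2) that] by simp
  show "has_boundary_function (disk_fun x) (l2_of_h2 x)"
    by (rule has_boundary_function_cong[OF hol eq f(2)])
  have "disk_fun x holomorphic_on ball 0 1"
    using hol by (rule holomorphic_transform) (simp add: eq)
  moreover have "(\<lambda>r::real. \<integral>z. (cmod (f (of_real r * z)))\<^sup>2 \<partial>circle_measure) ` {0<..<1} =
      (\<lambda>r::real. \<integral>z. (cmod (disk_fun x (of_real r * z)))\<^sup>2 \<partial>circle_measure) ` {0<..<1}"
    by (intro image_cong Bochner_Integration.integral_cong) (auto simp: eq norm_mult)
  ultimately show "disk_fun x \<in> hardy2_disk"
    using f(1) by (simp add: hardy2_disk_def)
qed

lemma disk_fun_holomorphic: "disk_fun x holomorphic_on ball 0 1"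
  using disk_fun_hardy2_disk[of x] by (simp add: hardy2_disk_def)

lemma disk_fun_eqI:
  assumes "\<And>z. cmod z < 1 \<Longrightarrow> disk_fun x z = disk_fun y z"
  shows "x = y"
proof -
  have "has_boundary_function (disk_fun y) (l2_of_h2 x)"
    by (rule has_boundary_function_cong[OF disk_fun_holomorphic assms has_boundary_function_disk_fun])
  then have "l2_of_h2 x = l2_of_h2 y"
    using has_boundary_function_disk_fun by (rule has_boundary_function_unique)
  then show ?thesis by (simp add: l2_of_h2_inject)
qed

lemma disk_fun_add: "disk_fun (x + y) z = disk_fun x z + disk_fun y z"
  by (simp add: disk_fun_def cinner_h2_add_left)

lemma disk_fun_scaleC: "disk_fun (scaleC_h2 c x) z = c * disk_fun x z"
  by (simp add: disk_fun_def cinner_h2_scaleC_left)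

section \<open>Analytic Toeplitz operators are the multiplication operators\<close>

lemma square_integrable_linf_mult:
  assumes "\<phi> \<in> linf" "square_integrable f"
  shows "square_integrable (\<lambda>z. \<phi> z * f z)"
proof -
  have [measurable]: "\<phi> \<in> borel_measurable circle_measure" "f \<in> borel_measurable circle_measure"
    using assms by (auto simp: linf_def square_integrable_def)
  obtain B where B: "AE z in circle_measure. cmod (\<phi> z) \<le> B"
    using assms by (auto simp: linf_def)
  have "integrable circle_measure (\<lambda>z. (cmod (\<phi> z * f z))\<^sup>2)"
  proof (rule Bochner_Integration.integrable_bound)
    show "integrable circle_measure (\<lambda>z. B\<^sup>2 * (cmod (f z))\<^sup>2)"
      using assms by (simp add: square_integrable_def)
    show "AE z in circle_measure. norm ((cmod (\<phi> z * f z))\<^sup>2) \<le> norm (B\<^sup>2 * (cmod (f z))\<^sup>2)"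
      using B by eventually_elim (simp add: norm_mult power_mult_distrib mult_right_mono power_mono)
  qed simp
  then show ?thesis by (simp add: square_integrable_def)
qed

lemma norm_l2_class_mult_le:
  assumes "\<phi> \<in> linf" "square_integrable f" "B \<ge> 0" "AE z in circle_measure. cmod (\<phi> z) \<le> B"
  shows "norm (l2_class (\<lambda>z. \<phi> z * f z)) \<le> B * norm (l2_class f)"
proof (rule norm_l2_class_le_mult)
  show "AE z in circle_measure. cmod (\<phi> z * f z) \<le> B * cmod (f z)"
    using assms(4) by eventually_elim (simp add: norm_mult mult_right_mono)
qed (use assms square_integrable_linf_mult in auto)

lemma linf_disk_algebra: "F \<in> disk_algebra \<Longrightarrow> F \<in> linf"
proof -
  assume F: "F \<in> disk_algebra"
  obtain B where "\<And>z. cmod z \<le> 1 \<Longrightarrow> cmod (F z) \<le> B" using disk_algebra_bounded[OF F] by blast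
  then have "AE z in circle_measure. cmod (F z) \<le> B" by (intro AE_I2) simp
  then show ?thesis using square_integrable_disk_algebra[OF F]
    by (auto simp: linf_def square_integrable_def)
qed

lemma square_integrable_linf: "\<phi> \<in> linf \<Longrightarrow> square_integrable \<phi>"
  using square_integrable_linf_mult[of \<phi> "\<lambda>_. 1"]
    square_integrable_disk_algebra[OF disk_algebra_const[of 1]] by simp

lemma linf_diff:
  assumes "\<phi> \<in> linf" "\<psi> \<in> linf"
  shows "(\<lambda>z. \<phi> z - \<psi> z) \<in> linf"
proof -
  have [measurable]: "\<phi> \<in> borel_measurable circle_measure" "\<psi> \<in> borel_measurable circle_measure"
    using assms by (auto simp: linf_def)
  obtain A B where "AE z in circle_measure. cmod (\<phi> z) \<le> A" "AE z in circle_measure. cmod (\<psi> z) \<le> B"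
    using assms by (auto simp: linf_def)
  then have "AE z in circle_measure. cmod (\<phi> z - \<psi> z) \<le> A + B"
    by eventually_elim (rule order.trans[OF norm_triangle_ineq4 add_mono])
  then show ?thesis by (auto simp: linf_def)
qed

text \<open>Write \<open>f\<^sub>r\<close> for the dilates. In
  \<open>f\<^sub>r g\<^sub>r - \<phi> u = f\<^sub>r (g\<^sub>r - u) + (f\<^sub>r - \<phi>) g\<^sub>s + (f\<^sub>r - \<phi>) (u - g\<^sub>s)\<close>
  the first and last factors are uniformly bounded, and for fixed \<open>s\<close> the function \<open>g\<^sub>s\<close> is
  bounded, so all three terms can be made small in \<open>L\<^sup>2\<close>.\<close>

lemma has_boundary_function_mult:
  assumes f: "f \<in> hinf_disk" "has_boundary_function f (l2_class \<phi>)" and \<phi>: "\<phi> \<in> linf"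
    and g: "g holomorphic_on ball 0 1" "has_boundary_function g u"
  shows "has_boundary_function (\<lambda>z. f z * g z) (l2_class (\<lambda>z. \<phi> z * rep_l2 u z))"
  unfolding has_boundary_function_def
proof (rule tendstoI)
  fix e :: real assume e: "e > 0"
  let ?d = "\<lambda>f (r::real) z. f (of_real r * z) :: complex"
  let ?U = "rep_l2 u"
  have fh: "f holomorphic_on ball 0 1" using f by (simp add: hinf_disk_def)
  obtain M where M: "M > 0" "\<And>z. cmod z < 1 \<Longrightarrow> cmod (f z) \<le> M"
    using f by (force simp: hinf_disk_def bounded_pos)
  obtain B0 where B0: "AE z in circle_measure. cmod (\<phi> z) \<le> B0"
    using \<phi> by (auto simp: linf_def)
  define B where "B = max B0 0"
  have B: "B \<ge> 0" "AE z in circle_measure. cmod (\<phi> z) \<le> B"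
    using B0 by (auto simp: B_def elim: eventually_mono)
  \<comment> \<open>The first and third terms are bounded by \<open>M * \<delta>\<close> and \<open>(M + B) * \<delta>\<close>; together they stay
    below \<open>e / 2\<close>.\<close>
  define \<delta> where "\<delta> = e / (4 * (2 * M + B + 1))"
  have \<delta>: "\<delta> > 0" "(2 * M + B) * \<delta> < e/4 + e/4"
    using e M(1) B(1) by (auto simp: \<delta>_def field_simps add_pos_nonneg)
  have evg: "\<forall>\<^sub>F r in at_left 1. dist (l2_class (?d g r)) u < \<delta>"
    using g(2) \<delta>(1) unfolding has_boundary_function_def by (rule tendstoD)
  have "\<exists>s. dist (l2_class (?d g s)) u < \<delta> \<and> s \<in> {0<..<1}"
    using eventually_happens'[OF trivial_limit_at_left_real eventually_conj[OF evg eventually_at_left_1]] .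
  then obtain s where s: "dist (l2_class (?d g s)) u < \<delta>" "s \<in> {0<..<1}" by blast
  have gs: "?d g s \<in> disk_algebra" by (rule disk_algebra_dilate[OF g(1) s(2)])
  obtain G where G: "G > 0" "\<And>z. cmod z \<le> 1 \<Longrightarrow> cmod (?d g s z) \<le> G"
    using disk_algebra_bounded[OF gs] by blast
  have evf: "\<forall>\<^sub>F r in at_left 1. dist (l2_class (?d f r)) (l2_class \<phi>) < e / (4 * G)"
    using f(2) e G(1) unfolding has_boundary_function_def by (intro tendstoD) auto
  show "\<forall>\<^sub>F r in at_left 1. dist (l2_class (?d (\<lambda>z. f z * g z) r)) (l2_class (\<lambda>z. \<phi> z * ?U z)) < e"
    using eventually_at_left_1 evf evg
  proof eventually_elim
    case (elim r)
    have fr: "?d f r \<in> disk_algebra" and gr: "?d g r \<in> disk_algebra"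
      using disk_algebra_dilate[OF fh elim(1)] disk_algebra_dilate[OF g(1) elim(1)] by auto
    have frM: "AE z in circle_measure. cmod (?d f r z) \<le> M"
      using elim(1) by (intro AE_I2 M(2)) (auto simp: norm_mult)
    note si [simp] = square_integrable_disk_algebra[OF fr] square_integrable_disk_algebra[OF gr]
      square_integrable_disk_algebra[OF gs] rep_l2(1)[of u] square_integrable_linf[OF \<phi>]
    note li [simp] = linf_disk_algebra[OF fr] linf_disk_algebra[OF gs] \<phi> linf_diff[OF linf_disk_algebra[OF fr] \<phi>]
    have d: "\<And>h k. square_integrable h \<Longrightarrow> square_integrable k \<Longrightarrow> 
        dist (l2_class h) (l2_class k) = norm (l2_class (\<lambda>z. h z - k z))"
      by (simp add: dist_norm l2_class_diff)
    define T1 where "T1 = (\<lambda>z. ?d f r z * (?d g r z - ?U z))"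
    define T2 where "T2 = (\<lambda>z. ?d g s z * (?d f r z - \<phi> z))"
    define T3 where "T3 = (\<lambda>z. (?d f r z - \<phi> z) * (?U z - ?d g s z))"
    have siT: "square_integrable T1" "square_integrable T2" "square_integrable T3"
      unfolding T1_def T2_def T3_def by (intro square_integrable_linf_mult li si square_integrable_diff)+
    have T1: "norm (l2_class T1) \<le> M * \<delta>"
    proof -
      have "norm (l2_class T1) \<le> M * norm (l2_class (\<lambda>z. ?d g r z - ?U z))"
        unfolding T1_def using M(1) frM by (intro norm_l2_class_mult_le li si square_integrable_diff) auto
      also have "norm (l2_class (\<lambda>z. ?d g r z - ?U z)) \<le> \<delta>"
        using elim(3) d[OF si(2) si(4)] by (simp add: rep_l2(2))
      finally show ?thesis using M(1) by simp
    qed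
    have T2: "norm (l2_class T2) \<le> G * (e / (4 * G))"
    proof -
      have "norm (l2_class T2) \<le> G * norm (l2_class (\<lambda>z. ?d f r z - \<phi> z))"
        unfolding T2_def using G by (intro norm_l2_class_mult_le li si square_integrable_diff AE_I2) auto
      also have "norm (l2_class (\<lambda>z. ?d f r z - \<phi> z)) \<le> e / (4 * G)"
        using elim(2) d[OF si(1) si(5)] by simp
      finally show ?thesis using G(1) by simp
    qed
    have T3: "norm (l2_class T3) \<le> (M + B) * \<delta>"
    proof -
      have "AE z in circle_measure. cmod (?d f r z - \<phi> z) \<le> M + B"
        using frM B(2) by eventually_elim (rule order.trans[OF norm_triangle_ineq4 add_mono])
      then have "norm (l2_class T3) \<le> (M + B) * norm (l2_class (\<lambda>z. ?U z - ?d g s z))"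
        unfolding T3_def using M(1) B(1) by (intro norm_l2_class_mult_le li si square_integrable_diff) auto
      also have "norm (l2_class (\<lambda>z. ?U z - ?d g s z)) \<le> \<delta>"
        using s(1) d[OF si(4) si(3)] by (simp add: rep_l2(2) dist_commute)
      finally show ?thesis using M(1) B(1) by simp
    qed
    have "dist (l2_class (?d (\<lambda>z. f z * g z) r)) (l2_class (\<lambda>z. \<phi> z * ?U z)) =
        norm (l2_class (\<lambda>z. ?d f r z * ?d g r z - \<phi> z * ?U z))"
      by (intro d square_integrable_linf_mult li si)
    also have "(\<lambda>z. ?d f r z * ?d g r z - \<phi> z * ?U z) = (\<lambda>z. (T1 z + T2 z) + T3 z)"
      by (simp add: T1_def T2_def T3_def fun_eq_iff algebra_simps)
    also have "l2_class \<dots> = l2_class T1 + l2_class T2 + l2_class T3"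
      by (simp only: l2_class_add siT square_integrable_add)
    also have "norm \<dots> \<le> M * \<delta> + G * (e / (4 * G)) + (M + B) * \<delta>"
      by (intro order.trans[OF norm_triangle_ineq] add_mono T1 T2 T3)
    also have "\<dots> = (2 * M + B) * \<delta> + e / 4"
      using G(1) by (simp add: algebra_simps)
    also have "\<dots> < e" using \<delta>(2) e by linarith
    finally show ?case .
  qed
qed

lemma l2_class_eq_0D:
  assumes "square_integrable f" "l2_class f = 0"
  shows "AE z in circle_measure. f z = 0"
proof -
  have "(\<integral>z. (cmod (f z))\<^sup>2 \<partial>circle_measure) = 0"
    using norm_l2_class_square[OF assms(1)] assms(2) by simp
  then have "AE z in circle_measure. (cmod (f z))\<^sup>2 = 0"
    using assms(1) by (subst (asm) integral_nonneg_eq_0_iff_AE) (auto simp: square_integrable_def)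
  then show ?thesis by eventually_elim simp
qed

text \<open>The excess \<open>max 0 (cmod u - M)\<close> is at most \<open>cmod (u - f\<^sub>r)\<close> for every dilate \<open>f\<^sub>r\<close>, whence
  its norm vanishes.\<close>

lemma boundary_function_bounded:
  assumes f: "f holomorphic_on ball 0 1" "has_boundary_function f u"
    and M: "\<And>z. cmod z < 1 \<Longrightarrow> cmod (f z) \<le> M"
  shows "AE z in circle_measure. cmod (rep_l2 u z) \<le> M"
proof -
  define \<psi> where "\<psi> z = complex_of_real (max 0 (cmod (rep_l2 u z) - M))" for z
  have M0: "M \<ge> 0" using order.trans[OF norm_ge_zero M[of 0]] by simp
  have [measurable]: "rep_l2 u \<in> borel_measurable circle_measure"
    using rep_l2(1)[of u] by (simp add: square_integrable_def)
  have [measurable]: "\<psi> \<in> borel_measurable circle_measure" unfolding \<psi>_def by measurable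
  have "integrable circle_measure (\<lambda>z. (cmod (\<psi> z))\<^sup>2)"
  proof (rule Bochner_Integration.integrable_bound)
    show "integrable circle_measure (\<lambda>z. (cmod (rep_l2 u z))\<^sup>2)"
      using rep_l2(1)[of u] by (simp add: square_integrable_def)
    show "AE z in circle_measure. norm ((cmod (\<psi> z))\<^sup>2) \<le> norm ((cmod (rep_l2 u z))\<^sup>2)"
      using M0 by (intro AE_I2) (auto simp: \<psi>_def intro!: power_mono)
  qed simp
  then have si: "square_integrable \<psi>" by (simp add: square_integrable_def)
  have le: "\<forall>\<^sub>F r in at_left 1. norm (l2_class \<psi>) \<le> dist (l2_class (\<lambda>z. f (of_real r * z))) u"
    using eventually_at_left_1
  proof eventually_elim
    case (elim r)
    have sf: "square_integrable (\<lambda>z. f (of_real r * z))" by (rule square_integrable_dilate[OF f(1) elim])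
    have "norm (l2_class \<psi>) \<le> 1 * norm (l2_class (\<lambda>z. f (of_real r * z) - rep_l2 u z))"
    proof (intro norm_l2_class_le_mult si square_integrable_diff sf rep_l2 AE_I2)
      fix z assume "z \<in> space circle_measure"
      then have "cmod (f (of_real r * z)) \<le> M" using elim by (intro M) (auto simp: norm_mult)
      then have "cmod (rep_l2 u z) - M \<le> cmod (rep_l2 u z) - cmod (f (of_real r * z))" by simp
      also have "\<dots> \<le> cmod (f (of_real r * z) - rep_l2 u z)"
        by (metis norm_minus_commute norm_triangle_ineq2)
      finally show "cmod (\<psi> z) \<le> 1 * cmod (f (of_real r * z) - rep_l2 u z)" by (simp add: \<psi>_def)
    qed simp
    also have "\<dots> = dist (l2_class (\<lambda>z. f (of_real r * z))) u"
      by (simp add: dist_norm rep_l2(2) l2_class_diff[OF sf rep_l2(1), symmetric])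
    finally show ?case .
  qed
  have "((\<lambda>r::real. dist (l2_class (\<lambda>z. f (of_real r * z))) u) \<longlongrightarrow> 0) (at_left 1)"
    using f(2) unfolding has_boundary_function_def by (rule tendsto_dist_iff[THEN iffD1])
  then have "norm (l2_class \<psi>) \<le> 0"
    using le by (rule tendsto_lowerbound) (rule trivial_limit_at_left_real)
  then have "AE z in circle_measure. \<psi> z = 0" by (intro l2_class_eq_0D si) simp
  then show ?thesis by eventually_elim (simp add: \<psi>_def max_def split: if_splits)
qed

lemma h2_projection_l2_of_h2: "h2_projection (l2_of_h2 h) = h"
  unfolding h2_projection_def
proof (rule the_equality)
  show "\<forall>g. cinner_l2 (l2_of_h2 h - l2_of_h2 h) (l2_of_h2 g) = 0"
    using linear_0[OF bounded_linear.linear[OF bounded_linear_cinner_h2]]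
    by (simp add: cinner_h2.rep_eq zero_h2.rep_eq)
  fix h' assume "\<forall>g. cinner_l2 (l2_of_h2 h - l2_of_h2 h') (l2_of_h2 g) = 0"
  then have "cinner_h2 (h - h') (h - h') = 0"
    by (simp only: l2_of_h2_diff[symmetric] cinner_h2.rep_eq)
  then show "h' = h" by (simp add: cinner_h2_self)
qed

text \<open>The product \<open>\<phi> x\<close> is the boundary function of \<open>f * disk_fun x\<close>, so it already lies in \<open>H\<^sup>2\<close> and
  the projection leaves it unchanged.\<close>

lemma toeplitz_analytic:
  assumes \<phi>: "\<phi> \<in> linf" and f: "f \<in> hinf_disk" "has_boundary_function f (l2_class \<phi>)"
  shows "l2_of_h2 (toeplitz \<phi> x) = l2_class (\<lambda>z. \<phi> z * rep_l2 (l2_of_h2 x) z)"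
    and "cmod z < 1 \<Longrightarrow> disk_fun (toeplitz \<phi> x) z = f z * disk_fun x z"
proof -
  let ?w = "l2_class (\<lambda>z. \<phi> z * rep_l2 (l2_of_h2 x) z)"
  have b: "has_boundary_function (\<lambda>z. f z * disk_fun x z) ?w"
    by (intro has_boundary_function_mult f \<phi> disk_fun_holomorphic has_boundary_function_disk_fun)
  have fh: "f holomorphic_on ball 0 1" using f by (simp add: hinf_disk_def)
  then have h: "(\<lambda>z. f z * disk_fun x z) holomorphic_on ball 0 1"
    by (intro holomorphic_intros disk_fun_holomorphic)
  obtain M where M: "M > 0" "\<And>z. cmod z < 1 \<Longrightarrow> cmod (f z) \<le> M"
    using f by (force simp: hinf_disk_def bounded_pos)
  have "(\<lambda>z. f z * disk_fun x z) \<in> hardy2_disk"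
  proof -
    obtain A where A: "\<And>r::real. r \<in> {0<..<1} \<Longrightarrow>
        (\<integral>z. (cmod (disk_fun x (of_real r * z)))\<^sup>2 \<partial>circle_measure) \<le> A"
      using disk_fun_hardy2_disk[of x] unfolding hardy2_disk_def bdd_above_def mem_Collect_eq ball_simps by blast
    have "(\<integral>z. (cmod (f (of_real r * z) * disk_fun x (of_real r * z)))\<^sup>2 \<partial>circle_measure) \<le> M\<^sup>2 * A"
      if r: "r \<in> {0<..<1}" for r :: real
    proof -
      have s1: "square_integrable (\<lambda>z. disk_fun x (of_real r * z))"
        "square_integrable (\<lambda>z. f (of_real r * z) * disk_fun x (of_real r * z))"
        using square_integrable_dilate[OF disk_fun_holomorphic r] square_integrable_dilate[OF h r] by auto
      have "(\<integral>z. (cmod (f (of_real r * z) * disk_fun x (of_real r * z)))\<^sup>2 \<partial>circle_measure) \<le>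
         (\<integral>z. M\<^sup>2 * (cmod (disk_fun x (of_real r * z)))\<^sup>2 \<partial>circle_measure)"
      proof (intro integral_mono)
        fix z assume "z \<in> space circle_measure"
        then have "cmod (f (of_real r * z)) \<le> M" using r by (intro M) (auto simp: norm_mult)
        then show "(cmod (f (of_real r * z) * disk_fun x (of_real r * z)))\<^sup>2
            \<le> M\<^sup>2 * (cmod (disk_fun x (of_real r * z)))\<^sup>2"
          by (auto simp: norm_mult power_mult_distrib intro!: mult_right_mono power_mono)
      qed (use s1 in \<open>auto simp: square_integrable_def\<close>)
      also have "\<dots> \<le> M\<^sup>2 * A" using A[OF r] by (simp add: mult_left_mono)
      finally show ?thesis .
    qed
    then show ?thesis using h by (auto simp: hardy2_disk_def intro!: bdd_aboveI2[where M = "M\<^sup>2 * A"])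
  qed
  then have w: "l2_of_h2 (h2_of_l2 ?w) = ?w" using b by (rule l2_of_h2_of_l2)
  have "toeplitz \<phi> x = h2_projection (l2_of_h2 (h2_of_l2 ?w))"
    by (simp add: toeplitz_def w)
  then have "toeplitz \<phi> x = h2_of_l2 ?w" by (simp only: h2_projection_l2_of_h2)
  with w show *: "l2_of_h2 (toeplitz \<phi> x) = ?w" by simp
  show "disk_fun (toeplitz \<phi> x) z = f z * disk_fun x z" if "cmod z < 1"
    using disk_fun_eq[OF h _ that] b * by simp
qed

lemma analytic_toeplitz_multiplier:
  assumes "L \<in> analytic_toeplitz"
  obtains g where "g \<in> hinf_disk" "\<And>x z. cmod z < 1 \<Longrightarrow> disk_fun (L x) z = g z * disk_fun x z"
proof -
  obtain \<phi> f where "L = toeplitz \<phi>" "\<phi> \<in> linf" "f \<in> hinf_disk" "has_boundary_function f (l2_class \<phi>)"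
    using assms by (auto simp: analytic_toeplitz_def)
  then show ?thesis using toeplitz_analytic(2) by (intro that[of f]) auto
qed

text \<open>Applying \<open>L\<close> to the constant function \<open>1\<close> recovers the multiplier: \<open>g\<close> is the disk function of
  \<open>L 1\<close>. This shows at once that \<open>g\<close> is holomorphic on the disk and that it has a boundary function, and
  the latter is the symbol.\<close>

lemma analytic_toeplitzI:
  assumes g: "bounded (g ` ball 0 1)"
    and L: "\<And>x z. cmod z < 1 \<Longrightarrow> disk_fun (L x) z = g z * disk_fun x z"
  shows "L \<in> analytic_toeplitz"
proof -
  obtain M where M: "\<And>z. cmod z < 1 \<Longrightarrow> cmod (g z) \<le> M"
    using g by (force simp: bounded_pos)
  define y where "y = L (h2_of_disk (\<lambda>_. 1))"
  have yg: "disk_fun y z = g z" if "cmod z < 1" for z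
    by (simp add: y_def L that disk_fun_h2_of_disk disk_algebra_const)
  define \<phi> where "\<phi> = rep_l2 (l2_of_h2 y)"
  have b: "has_boundary_function (disk_fun y) (l2_class \<phi>)"
    using has_boundary_function_disk_fun by (simp add: \<phi>_def rep_l2)
  have "AE z in circle_measure. cmod (\<phi> z) \<le> M"
    unfolding \<phi>_def
    by (rule boundary_function_bounded[OF disk_fun_holomorphic has_boundary_function_disk_fun])
       (simp add: yg M)
  then have \<phi>: "\<phi> \<in> linf"
    using rep_l2(1)[of "l2_of_h2 y"] by (auto simp: linf_def \<phi>_def square_integrable_def)
  have f: "disk_fun y \<in> hinf_disk"
    unfolding hinf_disk_def bounded_iff using M yg by (auto intro!: exI[of _ M] disk_fun_holomorphic)
  have "L x = toeplitz \<phi> x" for x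
    by (rule disk_fun_eqI) (simp add: L toeplitz_analytic(2)[OF \<phi> f b] yg)
  then show ?thesis
    using \<phi> f b by (auto simp: analytic_toeplitz_def)
qed

lemma analytic_toeplitz_subset_h2_operators: "analytic_toeplitz \<subseteq> h2_operators"
proof
  fix L assume "L \<in> analytic_toeplitz"
  then obtain \<phi> f where L: "L = toeplitz \<phi>" and *: "\<phi> \<in> linf" "f \<in> hinf_disk" "has_boundary_function f (l2_class \<phi>)"
    by (auto simp: analytic_toeplitz_def)
  note t = toeplitz_analytic[OF *]
  obtain B0 where B0: "AE z in circle_measure. cmod (\<phi> z) \<le> B0"
    using * by (auto simp: linf_def)
  define B where "B = max B0 0"
  have B: "B \<ge> 0" "AE z in circle_measure. cmod (\<phi> z) \<le> B"
    using B0 by (auto simp: B_def elim: eventually_mono)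
  have scale: "L (scaleC_h2 c x) = scaleC_h2 c (L x)" for c x
    by (rule disk_fun_eqI) (simp add: L t(2) disk_fun_scaleC)
  have "bounded_linear L"
  proof (rule bounded_linear_intro)
    show "L (x + y) = L x + L y" for x y
      by (rule disk_fun_eqI) (simp add: L t(2) disk_fun_add distrib_left)
    show "L (r *\<^sub>R x) = r *\<^sub>R L x" for r x by (simp add: scaleR_h2_def scale)
    show "norm (L x) \<le> norm x * B" for x
      using norm_l2_class_mult_le[OF *(1) rep_l2(1) B, of "l2_of_h2 x"]
      by (simp add: L t(1) rep_l2(2) norm_l2_of_h2[symmetric] mult.commute)
  qed
  then show "L \<in> h2_operators" by (simp add: h2_operators_def scale)
qed

lemma toeplitz_disk_algebra:
  assumes "F \<in> disk_algebra"
  shows "toeplitz F \<in> analytic_toeplitz"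
    and "cmod z < 1 \<Longrightarrow> disk_fun (toeplitz F x) z = F z * disk_fun x z"
  using assms linf_disk_algebra disk_algebra_subset_hinf_disk has_boundary_function_disk_algebra toeplitz_analytic(2)[of F F]
  unfolding analytic_toeplitz_def by blast+

section \<open>Disk automorphisms and the orthonormal bases\<close>

text \<open>With \<open>z = w\<close> this gives the modulus of \<open>disk_aut a z\<close>, from which it is read off that
  \<open>disk_aut a\<close> preserves both the disk and the circle.\<close>

lemma disk_aut_identity:
  assumes "cmod a < 1" "cmod z \<le> 1" "cmod w \<le> 1"
  shows "1 - cnj (disk_aut a z) * disk_aut a w =
    of_real (1 - (cmod a)\<^sup>2) * (1 - cnj z * w) / ((1 - a * cnj z) * (1 - cnj a * w))"
proof -
  have nz: "1 - a * cnj z \<noteq> 0" "1 - cnj a * w \<noteq> 0" using norm_cnj_mult_less_1 assms by auto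
  have "of_real (1 - (cmod a)\<^sup>2) = 1 - a * cnj a" by (simp only: of_real_diff complex_norm_square of_real_1)
  then show ?thesis using nz
    by (simp add: disk_aut_def divide_simps) (simp add: algebra_simps)
qed

lemma one_minus_norm_disk_aut:
  assumes "cmod a < 1" "cmod z \<le> 1"
  shows "1 - (cmod (disk_aut a z))\<^sup>2 = (1 - (cmod a)\<^sup>2) * (1 - (cmod z)\<^sup>2) / (cmod (1 - cnj a * z))\<^sup>2"
proof -
  have "complex_of_real (1 - (cmod (disk_aut a z))\<^sup>2) = 1 - cnj (disk_aut a z) * disk_aut a z"
    by (simp only: of_real_diff complex_norm_square of_real_1 mult.commute)
  also have "\<dots> = of_real (1 - (cmod a)\<^sup>2) * (1 - cnj z * z) / ((1 - a * cnj z) * (1 - cnj a * z))"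
    by (rule disk_aut_identity) (use assms in auto)
  also have "1 - cnj z * z = of_real (1 - (cmod z)\<^sup>2)"
    by (simp only: of_real_diff complex_norm_square of_real_1 mult.commute)
  also have "(1 - a * cnj z) * (1 - cnj a * z) = (1 - cnj a * z) * cnj (1 - cnj a * z)" by simp
  also have "\<dots> = of_real ((cmod (1 - cnj a * z))\<^sup>2)" by (simp only: complex_norm_square)
  finally show ?thesis by (simp only: of_real_mult[symmetric] of_real_divide[symmetric] of_real_eq_iff)
qed

lemma one_minus_norm_square_pos: "cmod a < 1 \<Longrightarrow> 0 < 1 - (cmod a)\<^sup>2"
  using abs_square_less_1[of "cmod a"] by simp

lemma norm_disk_aut_less_1: 
  assumes "cmod a < 1" "cmod z < 1" shows "cmod (disk_aut a z) < 1"
proof -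
  have "0 < 1 - (cmod (disk_aut a z))\<^sup>2"
    using assms norm_cnj_mult_less_1(2)[of a z]
    by (subst one_minus_norm_disk_aut) (auto intro!: divide_pos_pos mult_pos_pos one_minus_norm_square_pos)
  then show ?thesis using abs_square_less_1[of "cmod (disk_aut a z)"] by simp
qed

lemma norm_disk_aut_eq_1: 
  assumes "cmod a < 1" "cmod z = 1" shows "cmod (disk_aut a z) = 1"
proof -
  have "1 - (cmod (disk_aut a z))\<^sup>2 = 0"
    using assms by (subst one_minus_norm_disk_aut) auto
  then show ?thesis by (simp add: power2_eq_1_iff) (metis norm_ge_zero neg_0_le_iff_le not_one_le_zero)
qed

lemma norm_disk_aut_le_1: "cmod a < 1 \<Longrightarrow> cmod z \<le> 1 \<Longrightarrow> cmod (disk_aut a z) \<le> 1"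
  using norm_disk_aut_less_1[of a z] norm_disk_aut_eq_1[of a z] by linarith

lemma disk_aut_involution:
  assumes "cmod a < 1" "cmod z \<le> 1"
  shows "disk_aut a (disk_aut a z) = z"
proof -
  have nz: "1 - cnj a * z \<noteq> 0" using norm_cnj_mult_less_1 assms by auto
  have "1 - cnj a * a \<noteq> 0" using norm_cnj_mult_less_1[of a a] assms by auto
  moreover have "1 - cnj a * disk_aut a z = (1 - cnj a * a) / (1 - cnj a * z)"
    "a - disk_aut a z = z * (1 - cnj a * a) / (1 - cnj a * z)"
    using nz by (simp_all add: disk_aut_def field_simps)
  ultimately show ?thesis using nz by (subst disk_aut_def) simp
qed

lemma disk_aut_disk_algebra: "cmod a < 1 \<Longrightarrow> disk_aut a \<in> disk_algebra"
  unfolding disk_aut_def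
  by (intro disk_algebra_holomorphicI holomorphic_intros) (auto dest: norm_cnj_mult_less_1)

lemma normalized_kernel_disk_algebra: "cmod a < 1 \<Longrightarrow> normalized_kernel a \<in> disk_algebra"
  unfolding normalized_kernel_def
  by (intro disk_algebra_mult disk_algebra_const szego_kernel_disk_algebra)

lemma normalized_kernel_nonzero: "cmod a < 1 \<Longrightarrow> cmod z \<le> 1 \<Longrightarrow> normalized_kernel a z \<noteq> 0"
  using one_minus_norm_square_pos[of a] norm_cnj_mult_less_1(2)[of a z]
  by (auto simp: normalized_kernel_def szego_kernel_def)

lemma aut_basis_disk_algebra:
  "cmod a < 1 \<Longrightarrow> (\<lambda>z. disk_aut a z ^ m * normalized_kernel a z) \<in> disk_algebra"
  by (intro disk_algebra_mult disk_algebra_power disk_aut_disk_algebra normalized_kernel_disk_algebra)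

lemma disk_fun_aut_basis:
  assumes "cmod a < 1" "cmod z < 1"
  shows "disk_fun (aut_basis a m) z = disk_aut a z ^ m * normalized_kernel a z"
  unfolding aut_basis_def using assms by (intro disk_fun_h2_of_disk aut_basis_disk_algebra)

text \<open>On the circle \<open>disk_aut a\<close> is unimodular, so for \<open>n \<le> m\<close> the inner product collapses to a
  value at \<open>a\<close> of \<open>disk_aut a ^ (m - n)\<close> by the reproducing property.\<close>

lemma cinner_aut_basis:
  assumes a: "cmod a < 1"
  shows "cinner_h2 (aut_basis a m) (aut_basis a n) = (if m = n then 1 else 0)"
proof -
  have *: "cinner_h2 (aut_basis a m) (aut_basis a n) = (if m = n then 1 else 0)" if "n \<le> m" for m n
  proof -
    define s where "s = complex_of_real (sqrt (1 - (cmod a)\<^sup>2))"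
    let ?F = "\<lambda>z. s * (disk_aut a z ^ (m - n) * normalized_kernel a z)"
    have "cinner_h2 (aut_basis a m) (aut_basis a n) =
      (\<integral>z. (disk_aut a z ^ m * normalized_kernel a z) * cnj (disk_aut a z ^ n * normalized_kernel a z) \<partial>circle_measure)"
      unfolding aut_basis_def by (intro cinner_h2_of_disk aut_basis_disk_algebra a)
    also have "\<dots> = (\<integral>z. ?F z * cnj (szego_kernel a z) \<partial>circle_measure)"
    proof (intro Bochner_Integration.integral_cong refl)
      fix z assume "z \<in> space circle_measure"
      then have "cmod (disk_aut a z) = 1" using a by (intro norm_disk_aut_eq_1) auto
      then have "disk_aut a z * cnj (disk_aut a z) = 1"
        using complex_norm_square[of "disk_aut a z"] by simp
      then have "disk_aut a z ^ n * cnj (disk_aut a z) ^ n = 1" by (simp flip: power_mult_distrib)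
      moreover have "disk_aut a z ^ m = disk_aut a z ^ n * disk_aut a z ^ (m - n)"
        using that by (simp flip: power_add)
      ultimately show "disk_aut a z ^ m * normalized_kernel a z * cnj (disk_aut a z ^ n * normalized_kernel a z)
          = ?F z * cnj (szego_kernel a z)"
        by (simp add: normalized_kernel_def s_def)
    qed
    also have "\<dots> = ?F a"
      by (intro circle_integral_szego a disk_algebra_mult disk_algebra_const aut_basis_disk_algebra)
    also have "\<dots> = (if m = n then 1 else 0)"
    proof -
      have "s * s = of_real (1 - (cmod a)\<^sup>2)"
        using one_minus_norm_square_pos[OF a] unfolding s_def of_real_mult[symmetric] by simp
      also have "\<dots> = 1 - cnj a * a" by (simp only: of_real_diff complex_norm_square of_real_1 mult.commute)
      finally have "s * normalized_kernel a a = 1"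
        using norm_cnj_mult_less_1(2)[of a a] a
        by (simp add: normalized_kernel_def szego_kernel_def flip: s_def)
      moreover have "disk_aut a a = 0" by (simp add: disk_aut_def)
      ultimately show ?thesis using that by (auto simp: power_0_left)
    qed
    finally show ?thesis .
  qed
  show ?thesis
  proof (cases "n \<le> m")
    case False
    then show ?thesis using *[of m n] cinner_h2_commute[of "aut_basis a m" "aut_basis a n"] by simp
  qed (rule *)
qed

lemma disk_fun_sum: "disk_fun (\<Sum>i\<in>I. x i) z = (\<Sum>i\<in>I. disk_fun (x i) z)"
  unfolding disk_fun_def by (rule linear_sum[OF bounded_linear.linear[OF bounded_linear_cinner_h2]])

lemma norm_h2_of_disk_diff_le:
  assumes "F \<in> disk_algebra" "G \<in> disk_algebra" "\<And>z. cmod z = 1 \<Longrightarrow> cmod (F z - G z) \<le> B"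
  shows "norm (h2_of_disk F - h2_of_disk G) \<le> B"
proof -
  have si: "square_integrable F" "square_integrable G"
    using assms by (auto intro: square_integrable_disk_algebra)
  have "norm (h2_of_disk F - h2_of_disk G) = norm (l2_class (\<lambda>z. F z - G z))"
    by (simp add: norm_l2_of_h2[symmetric] l2_of_h2_diff l2_of_h2_of_disk assms l2_class_diff si)
  also have "\<dots> \<le> B" by (intro norm_l2_class_le square_integrable_diff si assms)
  finally show ?thesis .
qed

text \<open>A dilate of \<open>disk_fun x\<close> has the form \<open>G (disk_aut a z) * normalized_kernel a z\<close> with \<open>G\<close> in the
  disk algebra, because \<open>disk_aut a\<close> is an involution of the closed disk; a polynomial approximating
  \<open>G\<close> gives the linear combination.\<close>

lemma aut_basis_dense:
  assumes a: "cmod a < 1" and e: "e > 0"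
  obtains c n where "norm (x - (\<Sum>i<n. scaleC_h2 (c i) (aut_basis a i))) < e"
proof -
  have "\<forall>\<^sub>F r in at_left 1. dist (h2_of_disk (\<lambda>z. disk_fun x (of_real r * z))) x < e/2"
    using e by (intro tendstoD h2_of_disk_dilates_tendsto disk_fun_holomorphic has_boundary_function_disk_fun) auto
  then have "\<exists>r. dist (h2_of_disk (\<lambda>z. disk_fun x (of_real r * z))) x < e/2 \<and> r \<in> {0<..<1}"
    using eventually_happens'[OF trivial_limit_at_left_real eventually_conj[OF _ eventually_at_left_1]] by blast
  then obtain r where r: "dist (h2_of_disk (\<lambda>z. disk_fun x (of_real r * z))) x < e/2" "r \<in> {0<..<1}" by blast
  define F where "F z = disk_fun x (of_real r * z)" for z
  have F: "F \<in> disk_algebra" unfolding F_def by (rule disk_algebra_dilate[OF disk_fun_holomorphic r(2)])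
  let ?e = "normalized_kernel a"
  \<comment> \<open>\<open>H = F / normalized_kernel a\<close>, written as a product that visibly lies in the disk algebra.\<close>
  define H where "H z = F z * (1 / of_real (sqrt (1 - (cmod a)\<^sup>2)) * (1 - cnj a * z))" for z
  have "(\<lambda>z. 1 / of_real (sqrt (1 - (cmod a)\<^sup>2)) * (1 - cnj a * z)) \<in> disk_algebra"
    by (intro disk_algebra_holomorphicI holomorphic_intros)
       (use one_minus_norm_square_pos[OF a] in auto)
  then have H: "H \<in> disk_algebra" unfolding H_def by (rule disk_algebra_mult[OF F])
  have HF: "H z * ?e z = F z" if "cmod z \<le> 1" for z
    using one_minus_norm_square_pos[OF a] norm_cnj_mult_less_1(2)[OF a that]
    by (auto simp: H_def normalized_kernel_def szego_kernel_def)
  have G: "(\<lambda>w. H (disk_aut a w)) \<in> disk_algebra"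
    by (rule disk_algebra_compose[OF H disk_aut_disk_algebra[OF a]])
       (use a norm_disk_aut_le_1 norm_disk_aut_less_1 in auto)
  obtain B where B: "B > 0" "\<And>z. cmod z \<le> 1 \<Longrightarrow> cmod (?e z) \<le> B"
    using disk_algebra_bounded[OF normalized_kernel_disk_algebra[OF a]] by blast
  have "e / (2 * B) > 0" using e B by simp
  from disk_algebra_polynomials_dense[OF G this] obtain c n where
    c: "\<And>w. cmod w \<le> 1 \<Longrightarrow> cmod (H (disk_aut a w) - (\<Sum>i<n. c i * w ^ i)) < e / (2 * B)" by blast
  define P where "P z = (\<Sum>i<n. c i * (disk_aut a z ^ i * ?e z))" for z
  have P: "P \<in> disk_algebra" unfolding P_def
    by (intro disk_algebra_sum disk_algebra_mult[OF disk_algebra_const] aut_basis_disk_algebra a)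
  have "cmod (F z - P z) \<le> e/2" if z: "cmod z = 1" for z
  proof -
    have "cmod (H (disk_aut a (disk_aut a z)) - (\<Sum>i<n. c i * disk_aut a z ^ i)) < e / (2 * B)"
      using z norm_disk_aut_eq_1[OF a z] by (intro c) auto
    then have 1: "cmod (H z - (\<Sum>i<n. c i * disk_aut a z ^ i)) \<le> e / (2 * B)"
      using z a by (simp add: disk_aut_involution)
    have "F z - P z = (H z - (\<Sum>i<n. c i * disk_aut a z ^ i)) * ?e z"
      using HF[of z] z by (simp add: P_def left_diff_distrib sum_distrib_right mult.assoc)
    then have "cmod (F z - P z) \<le> e / (2 * B) * B"
      using 1 B z e by (simp only: norm_mult) (intro mult_mono, auto)
    then show ?thesis using B(1) by simp
  qed
  then have "norm (h2_of_disk F - h2_of_disk P) \<le> e/2" by (intro norm_h2_of_disk_diff_le F P)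
  moreover have "h2_of_disk P = (\<Sum>i<n. scaleC_h2 (c i) (aut_basis a i))"
    by (rule disk_fun_eqI) (simp add: disk_fun_h2_of_disk P disk_fun_sum disk_fun_scaleC disk_fun_aut_basis a, simp add: P_def)
  moreover have "norm (x - h2_of_disk F) < e/2"
    using r(1) unfolding F_def by (simp add: dist_norm norm_minus_commute)
  ultimately have "norm ((x - h2_of_disk F) + (h2_of_disk F - (\<Sum>i<n. scaleC_h2 (c i) (aut_basis a i)))) < e"
    by (intro order.strict_trans1[OF norm_triangle_ineq]) simp
  then show ?thesis by (intro that[of c n]) simp
qed

lemma cinner_h2_diff_left: "cinner_h2 (x - y) z = cinner_h2 x z - cinner_h2 y z"
  by (rule linear_diff[OF bounded_linear.linear[OF bounded_linear_cinner_h2]])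

lemma cinner_h2_sum_left: "cinner_h2 (\<Sum>i\<in>I. x i) z = (\<Sum>i\<in>I. cinner_h2 (x i) z)"
  by (rule linear_sum[OF bounded_linear.linear[OF bounded_linear_cinner_h2]])

text \<open>Among all combinations of the first \<open>N\<close> basis vectors the Fourier partial sum is closest to \<open>x\<close>, since
  its error is orthogonal to them; the span being dense, the partial sums converge to \<open>x\<close>.\<close>

lemma aut_basis_sums:
  assumes a: "cmod a < 1"
  shows "(\<lambda>m. scaleC_h2 (cinner_h2 x (aut_basis a m)) (aut_basis a m)) sums x"
proof -
  define b where "b = aut_basis a"
  define S where "S n = (\<Sum>m<n. scaleC_h2 (cinner_h2 x (b m)) (b m))" for n
  have ob: "cinner_h2 (b m) (b n) = (if m = n then 1 else 0)" for m n
    unfolding b_def by (rule cinner_aut_basis[OF a])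
  have coeff: "cinner_h2 (\<Sum>m<N. scaleC_h2 (d m) (b m)) (b k) = (if k < N then d k else 0)" for d N k
    by (simp add: cinner_h2_sum_left cinner_h2_scaleC_left ob if_distrib sum.delta cong: if_cong)
  have best: "norm (x - S N) \<le> norm (x - (\<Sum>m<n. scaleC_h2 (c m) (b m)))" if "n \<le> N" for c n N
  proof -
    define q where "q = S N - (\<Sum>m<n. scaleC_h2 (c m) (b m))"
    have "cinner_h2 (b k) (x - S N) = 0" if "k < N" for k
      using that coeff[of "\<lambda>m. cinner_h2 x (b m)" N k]
      by (subst cinner_h2_commute) (simp add: cinner_h2_diff_left S_def)
    then have "cinner_h2 q (x - S N) = 0"
      using that by (simp add: q_def S_def cinner_h2_diff_left cinner_h2_sum_left cinner_h2_scaleC_left)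
    then have "inner q (x - S N) = 0" by (simp add: inner_h2_def)
    then have "(norm (x - S N))\<^sup>2 \<le> (norm ((x - S N) + q))\<^sup>2"
      by (simp add: power2_norm_eq_inner inner_add_left inner_add_right inner_commute)
    then have "norm (x - S N) \<le> norm ((x - S N) + q)" by (rule power2_le_imp_le) simp
    then show ?thesis by (simp add: q_def)
  qed
  have "S \<longlonglongrightarrow> x"
  proof (rule LIMSEQ_I)
    fix e :: real assume "e > 0"
    then obtain c n where cn: "norm (x - (\<Sum>m<n. scaleC_h2 (c m) (b m))) < e"
      using aut_basis_dense[OF a] unfolding b_def by metis
    show "\<exists>N. \<forall>k\<ge>N. norm (S k - x) < e"
      using order.strict_trans1[OF best cn] by (auto simp: norm_minus_commute)
  qed
  moreover have "S = (\<lambda>n. \<Sum>m<n. scaleC_h2 (cinner_h2 x (aut_basis a m)) (aut_basis a m))"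
    by (rule ext) (simp add: S_def b_def)
  ultimately show ?thesis unfolding sums_def by (simp only:)
qed

lemma aut_basis_coefficient:
  assumes a: "cmod a < 1" and x: "(\<lambda>m. scaleC_h2 (\<mu> m) (aut_basis a m)) sums x"
  shows "\<mu> n = cinner_h2 x (aut_basis a n)"
proof -
  have "(\<lambda>m. cinner_h2 (scaleC_h2 (\<mu> m) (aut_basis a m)) (aut_basis a n)) sums cinner_h2 x (aut_basis a n)"
    by (rule bounded_linear.sums[OF bounded_linear_cinner_h2 x])
  moreover have "(\<lambda>m. cinner_h2 (scaleC_h2 (\<mu> m) (aut_basis a m)) (aut_basis a n)) = (\<lambda>m. if m = n then \<mu> n else 0)"
    by (auto simp: cinner_h2_scaleC_left cinner_aut_basis[OF a])
  ultimately show ?thesis using sums_single[of n "\<lambda>_. \<mu> n"] sums_unique2 by fastforce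
qed

text \<open>The coefficients of \<open>x\<close> are unique, which makes the definite description in \<open>C_conj\<close> denote \<open>y\<close> as
  soon as the second series converges to \<open>y\<close>.\<close>

lemma C_conj_eqI:
  assumes a: "cmod a < 1"
    and y: "(\<lambda>m. scaleC_h2 (cnj (cinner_h2 x (aut_basis a m)) * cnj l ^ m) (aut_basis a m)) sums y"
  shows "C_conj l a x = y"
  unfolding C_conj_def
proof (rule the_equality)
  show "\<exists>\<mu>. (\<lambda>m. scaleC_h2 (\<mu> m) (aut_basis a m)) sums x \<and>
     (\<lambda>m. scaleC_h2 (cnj (\<mu> m) * cnj l ^ m) (aut_basis a m)) sums y"
    by (intro exI[of _ "\<lambda>m. cinner_h2 x (aut_basis a m)"] conjI aut_basis_sums[OF a] y)
  fix y' assume "\<exists>\<mu>. (\<lambda>m. scaleC_h2 (\<mu> m) (aut_basis a m)) sums x \<and>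
     (\<lambda>m. scaleC_h2 (cnj (\<mu> m) * cnj l ^ m) (aut_basis a m)) sums y'"
  then obtain \<mu> where \<mu>: "(\<lambda>m. scaleC_h2 (\<mu> m) (aut_basis a m)) sums x"
    and y': "(\<lambda>m. scaleC_h2 (cnj (\<mu> m) * cnj l ^ m) (aut_basis a m)) sums y'" by blast
  have "\<mu> = (\<lambda>m. cinner_h2 x (aut_basis a m))"
    using aut_basis_coefficient[OF a \<mu>] by (rule ext)
  with y y' show "y' = y" by (simp add: sums_unique2)
qed

section \<open>Conjugations and their action on multiplication operators\<close>

lemma h2_conjugationD:
  assumes "h2_conjugation C"
  shows "C (x + y) = C x + C y" "C (scaleC_h2 c x) = scaleC_h2 (cnj c) (C x)" "C (C x) = x"
    "cinner_h2 (C x) (C y) = cinner_h2 y x"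
  using assms unfolding h2_conjugation_def by blast+

lemma h2_conjugation_swap:
  assumes "h2_conjugation C" shows "cinner_h2 (C x) y = cinner_h2 (C y) x"
  using h2_conjugationD(3,4)[OF assms] by metis

lemma h2_conjugation_bounded_linear:
  assumes "h2_conjugation C" shows "bounded_linear C"
proof (rule bounded_linear_intro[where K = 1])
  fix x y :: h2 and r :: real
  show "C (x + y) = C x + C y" by (rule h2_conjugationD[OF assms])
  show "C (r *\<^sub>R x) = r *\<^sub>R C x" by (simp add: scaleR_h2_def h2_conjugationD[OF assms])
  have "complex_of_real ((norm (C x))\<^sup>2) = of_real ((norm x)\<^sup>2)"
    unfolding cinner_h2_self[symmetric] by (rule h2_conjugationD[OF assms])
  then have "(norm (C x))\<^sup>2 = (norm x)\<^sup>2" by (simp only: of_real_eq_iff)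
  then show "norm (C x) \<le> norm x * 1" by simp
qed

lemma scaleC_h2_simps:
  "scaleC_h2 c (scaleC_h2 d x) = scaleC_h2 (c * d) x" "scaleC_h2 1 x = x" "scaleC_h2 0 x = 0"
proof -
  interpret vs: vector_space scaleC_h2 by (rule vector_space_h2)
  show "scaleC_h2 c (scaleC_h2 d x) = scaleC_h2 (c * d) x" "scaleC_h2 1 x = x" "scaleC_h2 0 x = 0"
    by simp_all
qed

text \<open>Continuity of \<open>C\<close> makes the image of a convergent expansion converge, so a conjugation that acts
  diagonally on the basis is known everywhere.\<close>

lemma h2_conjugation_sums:
  assumes C: "h2_conjugation C" and a: "cmod a < 1"
    and b: "\<And>m. C (aut_basis a m) = scaleC_h2 (\<nu> m) (aut_basis a m)"
  shows "(\<lambda>m. scaleC_h2 (cnj (cinner_h2 x (aut_basis a m)) * \<nu> m) (aut_basis a m)) sums C x"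
  using bounded_linear.sums[OF h2_conjugation_bounded_linear[OF C] aut_basis_sums[OF a, of x]]
  by (simp add: h2_conjugationD[OF C] b scaleC_h2_simps)

lemma C_conj_aut_basis:
  assumes a: "cmod a < 1"
  shows "C_conj l a (aut_basis a m) = scaleC_h2 (cnj l ^ m) (aut_basis a m)"
proof (rule C_conj_eqI[OF a])
  have "scaleC_h2 (cnj (cinner_h2 (aut_basis a m) (aut_basis a k)) * cnj l ^ k) (aut_basis a k) =
      (if k = m then scaleC_h2 (cnj l ^ m) (aut_basis a m) else 0)" for k
    by (simp add: cinner_aut_basis[OF a] scaleC_h2_simps)
  then show "(\<lambda>k. scaleC_h2 (cnj (cinner_h2 (aut_basis a m) (aut_basis a k)) * cnj l ^ k) (aut_basis a k))
      sums scaleC_h2 (cnj l ^ m) (aut_basis a m)"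
    using sums_single[of m "\<lambda>_. scaleC_h2 (cnj l ^ m) (aut_basis a m)"] by simp
qed

lemma disk_fun_sums:
  assumes "f sums x" shows "(\<lambda>m. disk_fun (f m) z) sums disk_fun x z"
  unfolding disk_fun_def by (rule bounded_linear.sums[OF bounded_linear_cinner_h2 assms])

text \<open>The point \<open>w\<close> is chosen such that \<open>disk_aut a w = l * cnj (disk_aut a z)\<close>. Then the conjugate of the
  power series of \<open>x\<close> in \<open>disk_aut a\<close>, evaluated at \<open>w\<close>, is termwise the series of \<open>C x\<close> at \<open>z\<close>.\<close>

lemma disk_fun_C_conj:
  assumes C: "h2_conjugation C" and eq: "C = (\<lambda>x. scaleC_h2 \<gamma> (C_conj l a x))"
    and l: "cmod l = 1" and a: "cmod a < 1" and z: "cmod z < 1"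
  defines "w \<equiv> disk_aut a (l * cnj (disk_aut a z))"
  shows "cmod w < 1"
    and "disk_fun (C x) z = \<gamma> * normalized_kernel a z * cnj (disk_fun x w / normalized_kernel a w)"
proof -
  have lz: "cmod (l * cnj (disk_aut a z)) < 1"
    using l norm_disk_aut_less_1[OF a z] by (simp add: norm_mult)
  then show w: "cmod w < 1" unfolding w_def by (rule norm_disk_aut_less_1[OF a])
  have aw: "disk_aut a w = l * cnj (disk_aut a z)"
    unfolding w_def using lz by (intro disk_aut_involution a) auto
  define \<mu> where "\<mu> m = cinner_h2 x (aut_basis a m)" for m
  have Cb: "C (aut_basis a m) = scaleC_h2 (\<gamma> * cnj l ^ m) (aut_basis a m)" for m
    by (simp add: eq C_conj_aut_basis[OF a] scaleC_h2_simps)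
  have "(\<lambda>m. disk_fun (scaleC_h2 (cnj (\<mu> m) * (\<gamma> * cnj l ^ m)) (aut_basis a m)) z) sums disk_fun (C x) z"
    unfolding \<mu>_def by (rule disk_fun_sums[OF h2_conjugation_sums[OF C a Cb]])
  then have 1: "(\<lambda>m. \<gamma> * normalized_kernel a z * cnj (\<mu> m * disk_aut a w ^ m)) sums disk_fun (C x) z"
    by (simp add: disk_fun_scaleC disk_fun_aut_basis a z aw power_mult_distrib mult_ac)
  have "(\<lambda>m. disk_fun (scaleC_h2 (\<mu> m) (aut_basis a m)) w) sums disk_fun x w"
    unfolding \<mu>_def by (rule disk_fun_sums[OF aut_basis_sums[OF a]])
  then have "(\<lambda>m. \<mu> m * disk_aut a w ^ m * normalized_kernel a w) sums disk_fun x w"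
    by (simp add: disk_fun_scaleC disk_fun_aut_basis a w mult.assoc)
  then have "(\<lambda>m. \<mu> m * disk_aut a w ^ m * normalized_kernel a w / normalized_kernel a w) sums
      (disk_fun x w / normalized_kernel a w)"
    by (rule sums_divide)
  then have "(\<lambda>m. \<mu> m * disk_aut a w ^ m) sums (disk_fun x w / normalized_kernel a w)"
    using normalized_kernel_nonzero[of a w] a w by simp
  then have "(\<lambda>m. \<gamma> * normalized_kernel a z * cnj (\<mu> m * disk_aut a w ^ m)) sums
      (\<gamma> * normalized_kernel a z * cnj (disk_fun x w / normalized_kernel a w))"
    by (intro sums_mult) (simp only: sums_cnj)
  with 1 show "disk_fun (C x) z = \<gamma> * normalized_kernel a z * cnj (disk_fun x w / normalized_kernel a w)"
    by (rule sums_unique2)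
qed

text \<open>By the formula for \<open>C\<close> on disk functions, a multiplier \<open>g\<close> inside the outer \<open>C\<close> comes out as the
  factor \<open>cnj (g (\<psi> z))\<close> with \<open>\<psi> z = disk_aut a (l * cnj (disk_aut a z))\<close>, and what remains is
  \<open>C (C x) = x\<close>.\<close>

lemma C_conj_preserves_analytic_toeplitz:
  assumes C: "h2_conjugation C" and eq: "C = (\<lambda>x. scaleC_h2 \<gamma> (C_conj l a x))"
    and l: "cmod l = 1" and a: "cmod a < 1" and L: "L \<in> analytic_toeplitz"
  shows "C \<circ> L \<circ> C \<in> analytic_toeplitz"
proof -
  obtain g where g: "g \<in> hinf_disk" and Lg: "\<And>x z. cmod z < 1 \<Longrightarrow> disk_fun (L x) z = g z * disk_fun x z"
    using analytic_toeplitz_multiplier[OF L] by blast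
  define \<psi> where "\<psi> z = disk_aut a (l * cnj (disk_aut a z))" for z
  note formula = disk_fun_C_conj[OF C eq l a, folded \<psi>_def]
  show ?thesis
  proof (rule analytic_toeplitzI[where g = "\<lambda>z. cnj (g (\<psi> z))"])
    have "(\<lambda>z. cnj (g (\<psi> z))) ` ball 0 1 \<subseteq> cnj ` g ` ball 0 1"
      using formula(1) by auto
    moreover have "bounded (cnj ` g ` ball 0 1)"
      using g by (intro bounded_linear_image[OF _ bounded_linear_cnj]) (simp add: hinf_disk_def)
    ultimately show "bounded ((\<lambda>z. cnj (g (\<psi> z))) ` ball 0 1)" by (rule bounded_subset[rotated])
    fix x z assume z: "cmod z < 1"
    have "disk_fun ((C \<circ> L \<circ> C) x) z =
        \<gamma> * normalized_kernel a z * cnj (g (\<psi> z) * disk_fun (C x) (\<psi> z) / normalized_kernel a (\<psi> z))"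
      by (simp add: formula(2)[OF z, of "L (C x)"] Lg[OF formula(1)[OF z]])
    also have "\<dots> = cnj (g (\<psi> z)) * disk_fun (C (C x)) z"
      by (simp add: formula(2)[OF z, of "C x"])
    finally show "disk_fun ((C \<circ> L \<circ> C) x) z = cnj (g (\<psi> z)) * disk_fun x z"
      by (simp add: h2_conjugationD[OF C])
  qed
qed

section \<open>Conjugations preserving the analytic Toeplitz operators\<close>

lemma disk_fun_kernel: "cmod z < 1 \<Longrightarrow> cmod w < 1 \<Longrightarrow> disk_fun (kernel_h2 z) w = szego_kernel z w"
  by (rule disk_fun_h2_of_disk[OF szego_kernel_disk_algebra])

lemma kernel_nonzero: "cmod z < 1 \<Longrightarrow> kernel_h2 z \<noteq> 0"
proof
  assume "cmod z < 1" "kernel_h2 z = 0"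
  then have "disk_fun 0 0 = 1" using disk_fun_kernel[of z 0] by (simp add: szego_kernel_def)
  then show False using disk_fun_scaleC[of 0 0 0] by (simp add: scaleC_h2_simps)
qed

lemma kernel_eq_scaleC_imp_eq:
  assumes p: "cmod p < 1" and q: "cmod q < 1" and eq: "kernel_h2 p = scaleC_h2 c (kernel_h2 q)"
  shows "p = q"
proof -
  have *: "szego_kernel p w = c * szego_kernel q w" if "cmod w < 1" for w
    using arg_cong[OF eq, of "\<lambda>x. disk_fun x w"] that p q by (simp add: disk_fun_scaleC disk_fun_kernel)
  \<comment> \<open>Evaluation at \<open>0\<close> removes the constant; any other point then separates \<open>p\<close> from \<open>q\<close>.\<close>
  have "c = 1" using *[of 0] by (simp add: szego_kernel_def)
  then have "1 / (1 - cnj p * (1/2)) = 1 / (1 - cnj q * (1/2))"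
    using *[of "1/2"] by (simp add: szego_kernel_def)
  moreover have "1 - cnj p * (1/2) \<noteq> 0" "1 - cnj q * (1/2) \<noteq> 0"
    using norm_cnj_mult_less_1(2)[of p "1/2"] norm_cnj_mult_less_1(2)[of q "1/2"] p q by auto
  ultimately have "cnj p = cnj q" by (simp add: divide_simps)
  then show ?thesis by simp
qed

text \<open>The hypothesis says that \<open>v\<close> is an eigenvector of the adjoint of the shift, which determines
  its Taylor coefficients as a geometric sequence; square-summability forces \<open>cmod \<beta> < 1\<close>.\<close>

lemma backward_shift_eigenvector:
  assumes v: "v \<noteq> 0" and eig: "\<And>x. cinner_h2 (toeplitz (\<lambda>z. z) x) v = \<beta> * cinner_h2 x v"
  obtains c where "cmod \<beta> < 1" "v = scaleC_h2 c (kernel_h2 \<beta>)"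
proof -
  let ?b = "aut_basis 0"
  define \<kappa> where "\<kappa> = cinner_h2 (?b 0) v"
  \<comment> \<open>As \<open>disk_aut 0 z = - z\<close>, this is the monomial basis up to alternating signs.\<close>
  have fb: "disk_fun (?b m) z = (- z) ^ m" if "cmod z < 1" for m z
    using that by (simp add: disk_fun_aut_basis disk_aut_def normalized_kernel_def szego_kernel_def)
  have shift: "?b (Suc m) = scaleC_h2 (-1) (toeplitz (\<lambda>z. z) (?b m))" for m
    by (rule disk_fun_eqI) (simp add: disk_fun_scaleC toeplitz_disk_algebra(2)[OF disk_algebra_ident] fb)
  have bv: "cinner_h2 (?b m) v = (- \<beta>) ^ m * \<kappa>" for m
    by (induction m) (simp_all add: \<kappa>_def shift cinner_h2_scaleC_left eig)
  have "cinner_h2 v (?b m) = cnj ((- \<beta>) ^ m * \<kappa>)" for m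
    using bv[of m] cinner_h2_commute by metis
  then have sums: "(\<lambda>m. scaleC_h2 (cnj ((- \<beta>) ^ m * \<kappa>)) (?b m)) sums v"
    using aut_basis_sums[of 0 v] by simp
  have "\<kappa> \<noteq> 0"
  proof
    assume "\<kappa> = 0"
    then have "(\<lambda>m. 0) sums v" using sums by (simp add: scaleC_h2_simps)
    then show False using v sums_unique2[OF sums_zero] by metis
  qed
  have normb: "norm (?b m) = 1" for m
  proof -
    have "complex_of_real ((norm (?b m))\<^sup>2) = of_real 1"
      unfolding cinner_h2_self[symmetric] by (simp add: cinner_aut_basis)
    then have "(norm (?b m))\<^sup>2 = 1\<^sup>2" by (simp only: of_real_eq_iff power_one)
    then show ?thesis by (rule power2_eq_imp_eq) auto
  qed
  have "(\<lambda>m. norm (scaleC_h2 (cnj ((- \<beta>) ^ m * \<kappa>)) (?b m))) \<longlonglongrightarrow> 0"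
    using sums_summable[OF sums] summable_LIMSEQ_zero tendsto_norm_zero by blast
  then have "(\<lambda>m. cmod \<beta> ^ m * cmod \<kappa>) \<longlonglongrightarrow> 0"
    by (simp add: norm_scaleC_h2 normb norm_mult norm_power)
  then have "(\<lambda>m. cmod \<beta> ^ m * cmod \<kappa> / cmod \<kappa>) \<longlonglongrightarrow> 0 / cmod \<kappa>"
    using \<open>\<kappa> \<noteq> 0\<close> by (intro tendsto_divide tendsto_const) auto
  then have pow: "(\<lambda>m. cmod \<beta> ^ m) \<longlonglongrightarrow> 0" using \<open>\<kappa> \<noteq> 0\<close> by simp
  have \<beta>: "cmod \<beta> < 1"
  proof (rule ccontr)
    assume "\<not> cmod \<beta> < 1"
    then have "1 \<le> cmod \<beta> ^ m" for m by (simp add: one_le_power)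
    then have "(1::real) \<le> 0" using pow by (intro LIMSEQ_le_const) auto
    then show False by simp
  qed
  have "disk_fun v z = cnj \<kappa> * szego_kernel \<beta> z" if z: "cmod z < 1" for z
  proof -
    have "(\<lambda>m. disk_fun (scaleC_h2 (cnj ((- \<beta>) ^ m * \<kappa>)) (?b m)) z) sums disk_fun v z"
      by (rule disk_fun_sums[OF sums])
    then have "(\<lambda>m. cnj \<kappa> * (cnj \<beta> * z) ^ m) sums disk_fun v z"
      by (simp add: disk_fun_scaleC fb z mult_ac flip: power_mult_distrib)
    moreover have "(\<lambda>m. cnj \<kappa> * (cnj \<beta> * z) ^ m) sums (cnj \<kappa> * (1 / (1 - cnj \<beta> * z)))"
      using norm_cnj_mult_less_1(1)[of \<beta> z] \<beta> z by (intro sums_mult geometric_sums) auto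
    ultimately show ?thesis unfolding szego_kernel_def by (rule sums_unique2)
  qed
  then have "v = scaleC_h2 (cnj \<kappa>) (kernel_h2 \<beta>)"
    using \<beta> by (intro disk_fun_eqI) (simp add: disk_fun_scaleC disk_fun_kernel)
  with \<beta> show ?thesis by (rule that)
qed

text \<open>\<open>kernel_h2 z\<close> is an eigenvector of the adjoint of every analytic Toeplitz operator, in particular
  of \<open>C T\<^sub>z C\<close>; hence \<open>C (kernel_h2 z)\<close> is one of the adjoint of \<open>T\<^sub>z\<close>.\<close>

lemma conjugation_maps_kernels:
  assumes C: "h2_conjugation C"
    and inv: "\<And>L. L \<in> analytic_toeplitz \<Longrightarrow> C \<circ> L \<circ> C \<in> analytic_toeplitz"
  obtains h c where "h holomorphic_on ball 0 1"
    "\<And>z. cmod z < 1 \<Longrightarrow> cmod (h z) < 1"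
    "\<And>z. cmod z < 1 \<Longrightarrow> C (kernel_h2 z) = scaleC_h2 (c z) (kernel_h2 (cnj (h z)))"
proof -
  let ?M = "toeplitz (\<lambda>z. z)"
  obtain h where h: "h \<in> hinf_disk"
    and Ch: "\<And>x z. cmod z < 1 \<Longrightarrow> disk_fun ((C \<circ> ?M \<circ> C) x) z = h z * disk_fun x z"
    using analytic_toeplitz_multiplier[OF inv[OF toeplitz_disk_algebra(1)[OF disk_algebra_ident]]] by blast
  have "\<exists>c. cmod (cnj (h z)) < 1 \<and> C (kernel_h2 z) = scaleC_h2 c (kernel_h2 (cnj (h z)))" if z: "cmod z < 1" for z
  proof -
    have "C (kernel_h2 z) \<noteq> 0"
      using kernel_nonzero[OF z] h2_conjugationD(3)[OF C, of "kernel_h2 z"]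
        linear_0[OF bounded_linear.linear[OF h2_conjugation_bounded_linear[OF C]]] by metis
    moreover have "cinner_h2 (?M x) (C (kernel_h2 z)) = cnj (h z) * cinner_h2 x (C (kernel_h2 z))" for x
    proof -
      have "cinner_h2 (?M x) (C (kernel_h2 z)) = cnj (cinner_h2 (C (?M x)) (kernel_h2 z))"
        by (metis cinner_h2_commute h2_conjugation_swap[OF C])
      also have "cinner_h2 (C (?M x)) (kernel_h2 z) = h z * cinner_h2 (C x) (kernel_h2 z)"
        using Ch[OF z, of "C x"] by (simp add: disk_fun_def h2_conjugationD[OF C])
      also have "cinner_h2 (C x) (kernel_h2 z) = cnj (cinner_h2 x (C (kernel_h2 z)))"
        by (metis cinner_h2_commute h2_conjugation_swap[OF C])
      finally show ?thesis by simp
    qed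
    ultimately show ?thesis using backward_shift_eigenvector by metis
  qed
  then obtain c where "\<And>z. cmod z < 1 \<Longrightarrow> cmod (cnj (h z)) < 1 \<and> C (kernel_h2 z) = scaleC_h2 (c z) (kernel_h2 (cnj (h z)))"
    by metis
  moreover have "h holomorphic_on ball 0 1" using h by (simp add: hinf_disk_def)
  ultimately show ?thesis by (intro that[of h c]) auto
qed

lemma norm_disk_aut_kernel:
  assumes "cmod w < 1" "cmod z < 1"
  shows "1 - (cmod (disk_aut w z))\<^sup>2 = (1 - (cmod w)\<^sup>2) * (1 - (cmod z)\<^sup>2) * (cmod (szego_kernel w z))\<^sup>2"
  using assms by (simp add: one_minus_norm_disk_aut szego_kernel_def norm_divide power_divide)

text \<open>The pseudo-hyperbolic distance of two points is determined by the angle between their kernels,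
  and \<open>C\<close> preserves angles.\<close>

lemma conjugation_isometric_on_disk:
  assumes C: "h2_conjugation C" and \<psi>: "\<And>z. cmod z < 1 \<Longrightarrow> cmod (\<psi> z) < 1"
    and Ck: "\<And>z. cmod z < 1 \<Longrightarrow> C (kernel_h2 z) = scaleC_h2 (c z) (kernel_h2 (\<psi> z))"
    and z: "cmod z < 1" and w: "cmod w < 1"
  shows "(cmod (c z))\<^sup>2 * (1 - (cmod z)\<^sup>2) = 1 - (cmod (\<psi> z))\<^sup>2"
    and "cmod (disk_aut (\<psi> w) (\<psi> z)) = cmod (disk_aut w z)"
proof -
  have *: "cmod (c z) * cmod (c w) * cmod (szego_kernel (\<psi> w) (\<psi> z)) = cmod (szego_kernel w z)"
    if "cmod z < 1" "cmod w < 1" for z w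
  proof -
    have "cinner_h2 (C (kernel_h2 w)) (C (kernel_h2 z)) = cinner_h2 (kernel_h2 z) (kernel_h2 w)"
      by (rule h2_conjugationD[OF C])
    then have "c w * cnj (c z) * disk_fun (kernel_h2 (\<psi> w)) (\<psi> z) = disk_fun (kernel_h2 z) w"
      by (simp add: Ck that cinner_h2_scaleC_left cinner_h2_scaleC_right disk_fun_def mult_ac)
    then have "cmod (c w * cnj (c z) * szego_kernel (\<psi> w) (\<psi> z)) = cmod (szego_kernel z w)"
      by (simp add: disk_fun_kernel \<psi> that)
    also have "szego_kernel z w = cnj (szego_kernel w z)" by (simp add: szego_kernel_def mult.commute)
    finally show ?thesis by (simp add: norm_mult mult_ac)
  qed
  have pos: "1 - (cmod z)\<^sup>2 > 0" if "cmod z < 1" for z :: complex using one_minus_norm_square_pos[OF that] .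
  have k: "cmod (szego_kernel z z) = 1 / (1 - (cmod z)\<^sup>2)" if "cmod z < 1" for z
  proof -
    have "1 - cnj z * z = of_real (1 - (cmod z)\<^sup>2)"
      by (simp only: of_real_diff complex_norm_square of_real_1 mult.commute)
    then show ?thesis using pos[OF that] by (simp add: szego_kernel_def norm_divide del: of_real_diff)
  qed
  have c: "(cmod (c z))\<^sup>2 * (1 - (cmod z)\<^sup>2) = 1 - (cmod (\<psi> z))\<^sup>2" if "cmod z < 1" for z
    using *[OF that that] k[OF that] k[OF \<psi>[OF that]] pos[OF that] pos[OF \<psi>[OF that]]
    by (simp add: field_simps power2_eq_square)
  show "(cmod (c z))\<^sup>2 * (1 - (cmod z)\<^sup>2) = 1 - (cmod (\<psi> z))\<^sup>2" by (rule c[OF z])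
  have "1 - (cmod (disk_aut (\<psi> w) (\<psi> z)))\<^sup>2 =
      (1 - (cmod w)\<^sup>2) * (1 - (cmod z)\<^sup>2) * (cmod (c z) * cmod (c w) * cmod (szego_kernel (\<psi> w) (\<psi> z)))\<^sup>2"
    unfolding norm_disk_aut_kernel[OF \<psi>[OF w] \<psi>[OF z]] c[OF z, symmetric] c[OF w, symmetric]
    by (simp add: power_mult_distrib mult_ac)
  also have "\<dots> = 1 - (cmod (disk_aut w z))\<^sup>2"
    unfolding *[OF z w] norm_disk_aut_kernel[OF w z] ..
  finally show "cmod (disk_aut (\<psi> w) (\<psi> z)) = cmod (disk_aut w z)" by simp
qed

text \<open>The equality case of the Schwarz lemma.\<close>

lemma Schwarz_isometric:
  assumes F: "F holomorphic_on ball 0 1" and norm: "\<And>z. cmod z < 1 \<Longrightarrow> cmod (F z) = cmod z"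
  obtains \<alpha> where "cmod \<alpha> = 1" "\<And>z. cmod z < 1 \<Longrightarrow> F z = \<alpha> * z"
proof -
  have F0: "F 0 = 0" using norm[of 0] by simp
  have lt: "\<And>z. cmod z < 1 \<Longrightarrow> cmod (F z) < 1" using norm by simp
  have ex: "\<exists>z. cmod z < 1 \<and> z \<noteq> 0 \<and> cmod (F z) = cmod z"
    using norm[of "1/2"] by (intro exI[of _ "1/2"]) simp
  have "\<exists>\<alpha>. (\<forall>z. cmod z < 1 \<longrightarrow> F z = \<alpha> * z) \<and> cmod \<alpha> = 1"
    by (rule Schwarz_Lemma(3)[OF F F0 lt, of 0]) (use ex in auto)
  then show ?thesis using that by blast
qed

lemma cnj_disk_aut: "cnj (disk_aut a z) = disk_aut (cnj a) (cnj z)"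
  by (simp add: disk_aut_def)

text \<open>An isometric antiholomorphic involution swaps \<open>0\<close> with \<open>b = \<psi> 0\<close>, so it fixes their hyperbolic
  midpoint \<open>b / (1 + sqrt (1 - (cmod b)\<^sup>2))\<close>. To compute with this, the Schwarz lemma is used to find
  \<open>\<psi> z = disk_aut b (\<eta> * cnj z)\<close> for a unimodular \<open>\<eta>\<close>.\<close>

lemma antiholomorphic_involution_fixed_point:
  assumes h: "h holomorphic_on ball 0 1" and \<psi>: "\<And>z. \<psi> z = cnj (h z)"
    and lt: "\<And>z. cmod z < 1 \<Longrightarrow> cmod (\<psi> z) < 1"
    and iso: "\<And>z w. cmod z < 1 \<Longrightarrow> cmod w < 1 \<Longrightarrow> cmod (disk_aut (\<psi> w) (\<psi> z)) = cmod (disk_aut w z)"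
    and inv: "\<psi> (\<psi> 0) = 0"
  obtains a where "cmod a < 1" "\<psi> a = a"
proof -
  define b where "b = \<psi> 0"
  have b: "cmod b < 1" using lt[of 0] by (simp add: b_def)
  have "disk_aut (cnj b) holomorphic_on ball 0 1"
    using disk_algebraD(2)[OF disk_aut_disk_algebra[of "cnj b"]] b by simp
  moreover have "h ` ball 0 1 \<subseteq> ball 0 1" using lt by (auto simp: \<psi>)
  ultimately have hol: "(\<lambda>z. disk_aut (cnj b) (h z)) holomorphic_on ball 0 1"
    using holomorphic_on_compose_gen[OF h] by (simp add: o_def)
  have cF: "disk_aut (cnj b) (h z) = cnj (disk_aut b (\<psi> z))" for z by (simp add: cnj_disk_aut \<psi>)
  have "cmod (disk_aut (cnj b) (h z)) = cmod z" if "cmod z < 1" for z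
  proof -
    have "cmod (disk_aut b (\<psi> z)) = cmod (disk_aut 0 z)" unfolding b_def by (rule iso) (use that in auto)
    then show ?thesis unfolding cF complex_mod_cnj by (simp add: disk_aut_def)
  qed
  from Schwarz_isometric[OF hol this] obtain \<alpha> where
    \<alpha>: "cmod \<alpha> = 1" "\<And>z. cmod z < 1 \<Longrightarrow> disk_aut (cnj b) (h z) = \<alpha> * z" by blast
  define \<eta> where "\<eta> = cnj \<alpha>"
  have \<psi>_eq: "\<psi> z = disk_aut b (\<eta> * cnj z)" if z: "cmod z < 1" for z
  proof -
    have "disk_aut b (\<psi> z) = \<eta> * cnj z"
      using \<alpha>(2)[OF z] unfolding cF \<eta>_def by (metis complex_cnj_cnj complex_cnj_mult)
    then show ?thesis using disk_aut_involution[OF b, of "\<psi> z"] lt[OF z] by simp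
  qed
  have "disk_aut b (\<eta> * cnj b) = 0" using \<psi>_eq[OF b] inv by (simp add: b_def)
  moreover have "cmod (\<eta> * cnj b) < 1" using b \<alpha>(1) by (simp add: \<eta>_def norm_mult)
  ultimately have \<eta>b: "\<eta> * cnj b = b"
    using norm_cnj_mult_less_1(2)[of b "\<eta> * cnj b"] b by (simp add: disk_aut_def)
  define s where "s = sqrt (1 - (cmod b)\<^sup>2)"
  have s: "s > 0" "s\<^sup>2 = 1 - (cmod b)\<^sup>2"
    using one_minus_norm_square_pos[OF b] by (auto simp: s_def)
  define a where "a = b / of_real (1 + s)"
  have bb: "cnj b * b = of_real (1 - s\<^sup>2)" using s(2) complex_norm_square[of b] by (simp add: mult.commute)
  have s1: "complex_of_real (1 + s) \<noteq> 0" using s(1) of_real_eq_0_iff[of "1 + s", where 'a = complex] by linarith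
  have "cmod a = cmod b / (1 + s)" using s(1) by (simp add: a_def norm_divide del: of_real_add)
  also have "\<dots> \<le> cmod b" using s(1) by (simp add: divide_le_eq mult_left_le algebra_simps)
  finally have a: "cmod a < 1" using b by simp
  have "\<eta> * cnj a = a" using \<eta>b by (simp add: a_def)
  then have "\<psi> a = disk_aut b a" using \<psi>_eq[OF a] by simp
  also have "disk_aut b a = a"
  proof -
    have "1 - cnj b * a = of_real s"
    proof -
      have "cnj b * a = of_real (1 - s\<^sup>2) / of_real (1 + s)" by (simp only: a_def times_divide_eq_right bb)
      also have "\<dots> = of_real ((1 - s\<^sup>2) / (1 + s))" by (simp only: of_real_divide)
      also have "(1 - s\<^sup>2) / (1 + s) = 1 - s" using s(1) by (simp add: field_simps power2_eq_square)
      finally show ?thesis by simp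
    qed
    moreover have "b - a = of_real s * a"
    proof -
      have "b = of_real (1 + s) * a" using s1 by (simp add: a_def del: of_real_add)
      then show ?thesis by (simp add: algebra_simps)
    qed
    ultimately show ?thesis using s(1) by (simp add: disk_aut_def)
  qed
  finally show ?thesis using a that by blast
qed

text \<open>Let \<open>\<psi> = cnj h\<close> describe the action of \<open>C\<close> on kernels and let \<open>a\<close> be a fixed point of \<open>\<psi>\<close>. Then
  \<open>C\<close> turns multiplication by \<open>F\<close> into multiplication by \<open>cnj (F (\<psi> z))\<close>. For \<open>F = disk_aut a\<close> the new
  multiplier has the same modulus as \<open>disk_aut a\<close>, so by the Schwarz lemma it is \<open>k * disk_aut a\<close> with
  \<open>k\<close> unimodular. As \<open>C\<close> multiplies \<open>kernel_h2 a\<close> by a constant and \<open>disk_aut a\<close> shifts the basis, \<open>C\<close> is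
  diagonal with the entries \<open>c a * k ^ m\<close>.\<close>

lemma conjugation_is_C_conj:
  assumes C: "h2_conjugation C"
    and inv: "\<And>L. L \<in> analytic_toeplitz \<Longrightarrow> C \<circ> L \<circ> C \<in> analytic_toeplitz"
  shows "\<exists>\<gamma>\<in>sphere 0 1. \<exists>l\<in>sphere 0 1. \<exists>a\<in>ball 0 1. C = (\<lambda>x. scaleC_h2 \<gamma> (C_conj l a x))"
proof -
  obtain h c where h: "h holomorphic_on ball 0 1"
    and h1: "\<And>z. cmod z < 1 \<Longrightarrow> cmod (h z) < 1"
    and Ch: "\<And>z. cmod z < 1 \<Longrightarrow> C (kernel_h2 z) = scaleC_h2 (c z) (kernel_h2 (cnj (h z)))"
    using conjugation_maps_kernels[OF C inv] by blast
  define \<psi> where "\<psi> z = cnj (h z)" for z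
  have \<psi>: "cmod (\<psi> z) < 1" if "cmod z < 1" for z using h1[OF that] by (simp add: \<psi>_def)
  have Ck: "C (kernel_h2 z) = scaleC_h2 (c z) (kernel_h2 (\<psi> z))" if "cmod z < 1" for z
    using Ch[OF that] by (simp add: \<psi>_def)
  have norm_c: "(cmod (c z))\<^sup>2 * (1 - (cmod z)\<^sup>2) = 1 - (cmod (\<psi> z))\<^sup>2" if "cmod z < 1" for z
    by (rule conjugation_isometric_on_disk(1)[OF C _ _ that that]) (fact \<psi> Ck)+
  have iso: "cmod (disk_aut (\<psi> w) (\<psi> z)) = cmod (disk_aut w z)" if "cmod z < 1" "cmod w < 1" for z w
    by (rule conjugation_isometric_on_disk(2)[OF C _ _ that]) (fact \<psi> Ck)+
  have "\<psi> (\<psi> 0) = 0"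
  proof -
    have "kernel_h2 0 = C (C (kernel_h2 0))" by (simp add: h2_conjugationD[OF C])
    also have "\<dots> = scaleC_h2 (cnj (c 0) * c (\<psi> 0)) (kernel_h2 (\<psi> (\<psi> 0)))"
      using \<psi>[of 0] by (simp add: Ck h2_conjugationD[OF C] scaleC_h2_simps)
    finally show ?thesis using kernel_eq_scaleC_imp_eq[of 0 "\<psi> (\<psi> 0)"] \<psi> by simp
  qed
  then obtain a where a: "cmod a < 1" and fix_a: "\<psi> a = a"
    using antiholomorphic_involution_fixed_point[OF h \<psi>_def \<psi> iso] by blast

  have CTC: "disk_fun (C (toeplitz F (C x))) z = cnj (F (\<psi> z)) * disk_fun x z"
    if F: "F \<in> disk_algebra" and z: "cmod z < 1" for F x z
  proof -
    have sw: "disk_fun (C y) z = c z * cnj (disk_fun y (\<psi> z))" for y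
    proof -
      have "disk_fun (C y) z = cinner_h2 (C (kernel_h2 z)) y"
        unfolding disk_fun_def by (rule h2_conjugation_swap[OF C])
      also have "\<dots> = c z * cinner_h2 (kernel_h2 (\<psi> z)) y" by (simp add: Ck[OF z] cinner_h2_scaleC_left)
      also have "cinner_h2 (kernel_h2 (\<psi> z)) y = cnj (disk_fun y (\<psi> z))"
        unfolding disk_fun_def by (rule cinner_h2_commute)
      finally show ?thesis .
    qed
    have "disk_fun (C (toeplitz F (C x))) z = cnj (F (\<psi> z)) * disk_fun (C (C x)) z"
      by (simp add: sw[of "C x"] sw[of "toeplitz F (C x)"] toeplitz_disk_algebra(2)[OF F \<psi>[OF z]])
    then show ?thesis by (simp add: h2_conjugationD[OF C])
  qed

  let ?\<phi> = "disk_aut a"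
  note \<phi>DA = disk_aut_disk_algebra[OF a]
  have "(\<lambda>z. disk_aut (cnj a) (h (?\<phi> z))) holomorphic_on ball 0 1"
  proof -
    have "?\<phi> ` ball 0 1 \<subseteq> ball 0 1" using norm_disk_aut_less_1[OF a] by auto
    then have 1: "(\<lambda>z. h (?\<phi> z)) holomorphic_on ball 0 1"
      by (rule holomorphic_on_compose_gen[OF disk_algebraD(2)[OF \<phi>DA] h, unfolded o_def])
    have 2: "disk_aut (cnj a) holomorphic_on ball 0 1"
      using disk_algebraD(2)[OF disk_aut_disk_algebra[of "cnj a"]] a by simp
    have "(\<lambda>z. h (?\<phi> z)) ` ball 0 1 \<subseteq> ball 0 1" using norm_disk_aut_less_1[OF a] h1 by auto
    then show ?thesis by (rule holomorphic_on_compose_gen[OF 1 2, unfolded o_def])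
  qed
  moreover have U: "disk_aut (cnj a) (h z) = cnj (?\<phi> (\<psi> z))" for z by (simp add: cnj_disk_aut \<psi>_def)
  have "cmod (disk_aut (cnj a) (h (?\<phi> z))) = cmod z" if z: "cmod z < 1" for z
  proof -
    have "cmod (disk_aut (\<psi> a) (\<psi> (?\<phi> z))) = cmod (disk_aut a (?\<phi> z))"
      by (rule iso) (use norm_disk_aut_less_1[OF a z] a in auto)
    then show ?thesis unfolding U using z a by (simp add: fix_a disk_aut_involution)
  qed
  ultimately obtain k where k: "cmod k = 1" "\<And>z. cmod z < 1 \<Longrightarrow> disk_aut (cnj a) (h (?\<phi> z)) = k * z"
    using Schwarz_isometric by blast
  have u: "cnj (?\<phi> (\<psi> z)) = k * ?\<phi> z" if "cmod z < 1" for z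
    using k(2)[OF norm_disk_aut_less_1[OF a that]] that a by (simp add: U disk_aut_involution)

  have Cb: "C (aut_basis a m) = scaleC_h2 (c a * k ^ m) (aut_basis a m)" for m
  proof (induction m)
    case 0
    have "aut_basis a 0 = scaleC_h2 (of_real (sqrt (1 - (cmod a)\<^sup>2))) (kernel_h2 a)"
      by (rule disk_fun_eqI)
         (simp add: disk_fun_aut_basis a disk_fun_scaleC disk_fun_kernel normalized_kernel_def)
    then show ?case
      by (simp add: h2_conjugationD[OF C] Ck[OF a] fix_a scaleC_h2_simps mult.commute)
  next
    case (Suc m)
    have b: "aut_basis a (Suc m) = toeplitz ?\<phi> (aut_basis a m)"
      by (rule disk_fun_eqI) (simp add: toeplitz_disk_algebra(2)[OF \<phi>DA] disk_fun_aut_basis a mult.assoc)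
    have "aut_basis a m = C (scaleC_h2 (c a * k ^ m) (aut_basis a m))"
      by (simp add: Suc.IH[symmetric] h2_conjugationD(3)[OF C])
    then have "C (aut_basis a (Suc m)) = C (toeplitz ?\<phi> (C (scaleC_h2 (c a * k ^ m) (aut_basis a m))))"
      by (simp add: b)
    also have "\<dots> = scaleC_h2 (c a * k ^ Suc m) (aut_basis a (Suc m))"
      by (rule disk_fun_eqI)
         (simp add: CTC[OF \<phi>DA] u disk_fun_scaleC disk_fun_aut_basis a mult_ac)
    finally show ?case .
  qed

  have "(cmod (c a))\<^sup>2 * (1 - (cmod a)\<^sup>2) = 1 - (cmod a)\<^sup>2" using norm_c[OF a] by (simp add: fix_a)
  then have "(cmod (c a))\<^sup>2 = 1\<^sup>2" using one_minus_norm_square_pos[OF a] by simp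
  then have ca: "cmod (c a) = 1" by (rule power2_eq_imp_eq) auto
  then have ca': "cnj (c a) * c a = 1" using complex_norm_square[of "c a"] by (simp add: mult.commute)
  have "C x = scaleC_h2 (c a) (C_conj (cnj k) a x)" for x
  proof -
    have "(\<lambda>m. scaleC_h2 (cnj (c a)) (scaleC_h2 (cnj (cinner_h2 x (aut_basis a m)) * (c a * k ^ m)) (aut_basis a m)))
        sums scaleC_h2 (cnj (c a)) (C x)"
      by (rule bounded_linear.sums[OF bounded_linear_scaleC_h2 h2_conjugation_sums[OF C a Cb]])
    moreover have "cnj (c a) * (d * (c a * e)) = d * e" for d e
      using ca' by (metis mult.assoc mult.commute mult.right_neutral)
    ultimately have "(\<lambda>m. scaleC_h2 (cnj (cinner_h2 x (aut_basis a m)) * cnj (cnj k) ^ m) (aut_basis a m))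
        sums scaleC_h2 (cnj (c a)) (C x)"
      by (simp add: scaleC_h2_simps)
    then have "C_conj (cnj k) a x = scaleC_h2 (cnj (c a)) (C x)" by (rule C_conj_eqI[OF a])
    then show ?thesis using ca' by (simp add: scaleC_h2_simps mult.commute)
  qed
  then show ?thesis
    using ca k(1) a by (intro bexI[of _ "c a"] bexI[of _ "cnj k"] bexI[of _ a]) auto
qed

theorem theorem4p5:
  fixes C :: "h2 \<Rightarrow> h2" and \<Phi> :: "(h2 \<Rightarrow> h2) \<Rightarrow> (h2 \<Rightarrow> h2)"
  assumes "h2_conjugation C"
    and "\<And>L. L \<in> h2_operators \<Longrightarrow> \<Phi> L = C \<circ> L \<circ> C"
  shows "\<Phi> ` analytic_toeplitz \<subseteq> analytic_toeplitz \<longleftrightarrow>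
    (\<exists>\<gamma>\<in>sphere 0 1. \<exists>l\<in>sphere 0 1. \<exists>a\<in>ball 0 1. C = (\<lambda>x. scaleC_h2 \<gamma> (C_conj l a x)))"
proof -
  have "\<Phi> L = C \<circ> L \<circ> C" if "L \<in> analytic_toeplitz" for L
    using assms(2) analytic_toeplitz_subset_h2_operators that by blast
  then have "\<Phi> ` analytic_toeplitz \<subseteq> analytic_toeplitz \<longleftrightarrow>
      (\<forall>L\<in>analytic_toeplitz. C \<circ> L \<circ> C \<in> analytic_toeplitz)"
    by (auto simp: image_subset_iff)
  also have "\<dots> \<longleftrightarrow> (\<exists>\<gamma>\<in>sphere 0 1. \<exists>l\<in>sphere 0 1. \<exists>a\<in>ball 0 1. C = (\<lambda>x. scaleC_h2 \<gamma> (C_conj l a x)))"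
    (is "?inv \<longleftrightarrow> ?form")
  proof
    assume ?inv
    then show ?form by (intro conjugation_is_C_conj assms(1)) auto
  next
    assume ?form
    then obtain \<gamma> l a where "cmod l = 1" "cmod a < 1" "C = (\<lambda>x. scaleC_h2 \<gamma> (C_conj l a x))" by auto
    then show ?inv using C_conj_preserves_analytic_toeplitz[OF assms(1)] by blast
  qed
  finally show ?thesis .
qed

end
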